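(* Consider the plant $\dot x=Ax+Bu+Df$, $y=Lx$ and the scalar quantity $$\xi=p_1y^2+p_2u_1^2+p_3(|u_2|+\delta)^2,$$ where $u=u_1+u_2$, together with the representation $\xi(t)=\Phi(\varepsilon(t),t)$, $\varepsilon(t)\in\mathbb R$ (all as described in the context). Let $\Phi$ satisfy: (a) $\underline g(t)<\Phi(\varepsilon,t)<\overline g(t)$ for all $t\ge 0$ and $\varepsilon\in\mathbb R$; (b) the inverse map $\varepsilon=\Phi^{-1}(\xi,t)$ exists for all $\xi$ with $\underline g(t)<\xi<\overline g(t)$ and all $t\ge0$; (c) $\Phi$ is continuously differentiable in $\varepsilon$ and $t$, and $\frac{\partial\Phi(\varepsilon,t)}{\partial\varepsilon}\ne 0$ for all $\varepsilon\in\mathbb R$, $t\ge0$; (d) $\left|\frac{\partial\Phi(\varepsilon,t)}{\partial t}\right|\le\gamma$ with $\gamma>0$, for all $\varepsilon\in\mathbb R$, $t\ge0$; and moreover $\frac{\partial\Phi(\varepsilon,t)}{\partial\varepsilon}>0$ for all $\varepsilon$ and $t$. Suppose that for given $\delta>0$, $\mu>0$, $p_1>0$, $p_2>0$, $p_3>0$, $\beta>0$, $c>0$ and $k\in\mathbb R$, with $\bar A=A+kBL$ and $\bar p_1=p_1+k^2p_2$, there exist a matrix $H>0$ and numbers $\alpha>0$, $\tau_i>0$, $i=1,\dots,5$, such that for both $v=\hat\phi$ and $v=-\hat\phi$ the following inequalities hold: $$\begin{bmatrix} -\alpha+0.5\tau_1 & 0.5\,v\,\mu^{-1} & -0.5\\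 * & -\tau_2 & 0\\ * & * & -\tau_3\end{bmatrix}\le 0,\qquad c\,\tau_1\ge \hat\phi^2\tau_2+\gamma^2\tau_3,$$ $$\begin{bmatrix}\bar A^{\rm T}H+H\bar A+\beta H & HB & HD\\ * & -\tau_4 & 0\\ * & * & -\tau_5\end{bmatrix}\le 0,\qquad H\ge\bar p_1L^{\rm T}L,$$ $$\frac{\inf_{t}\overline g(t)}{\bar p_1}\,\beta\ \ge\ \frac{\inf_{t}\overline g(t)}{p_3}\,\tau_4+\hat\phi^2\tau_5 .$$ Then the control law $u=u_1+u_2$ with $$u_1=ky,$$ $$\dot u_2=-\frac{1}{2p_3(|u_2|+\delta)}\,\mathrm{sign}(u_2)\left[\alpha\varepsilon+2\bar p_1\,y\,\frac{pR(p)}{\bar Q(p)}u_2+\mu\,\bar p_1^2\,\mathrm{sign}(\varepsilon)\,y^2\right]$$ ensures that $$\underline g(t)<\xi(t)<\overline g(t)\quad\text{for all } t\ge 0.$$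
   Context: Plant: $\dot x=Ax+Bu+Df$, $y=Lx$, $t\ge0$, with state $x(t)\in\mathbb R^n$, scalar control $u(t)\in\mathbb R$, scalar output $y(t)\in\mathbb R$, and scalar disturbance $f(t)\in\mathbb R$ (piecewise continuous in $t$) satisfying $|f(t)|\le\bar f$ for all $t$. Here $A\in\mathbb R^{n\times n}$, $B\in\mathbb R^{n\times1}$, $D\in\mathbb R^{n\times1}$, $L\in\mathbb R^{1\times n}$. Plants are assumed stabilizable and observable, and this plant is strictly minimum-phase (the polynomial $R$ below is Hurwitz). Constraint sets specified by the designer: $\mathcal Y=\{y\in\mathbb R: p_1y^2\le l_y(t)\}$ and $\mathcal U=\{u\in\mathbb R: p_0u^2\le l_u(t)\}$, with $p_1>0$, $p_0>0$, $l_y(t)>0$, $l_u(t)>0$. The control is split as $u=u_1+u_2$. With some $r>0$, $p_2=p_0(1+r)$ and $p_3=p_0(1+r^{-1})$, so that $p_0u^2\le p_2u_1^2+p_3u_2^2$. The number $\delta>0$ is chosen by the designer. The functions $\underline g(t)$ and $\overline g(t)$ are continuously differentiable scalar functions of $t\ge0$, with $\overline g(t)=\inf\{l_y(t),l_u(t)\}$. The control goal is $\xi(t)\in\mathcal S=\{\xi\in\mathbb R:\underline g(t)<\xi<\overline g(t)\}$ for all $t\ge0$. Change of variable: $\xi(t)=\Phi(\varepsilon(t),t)$, where $\varepsilon(t)\in\mathbb R$ is continuously differentiable in $t$; that is, $\varepsilon(t)=\Phi^{-1}(\xi(t),t)$. In particular the initial data are such that $\xi(0)=\Phi(\varepsilon(0),0)$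 for some $\varepsilon(0)\in\mathbb R$, so $\underline g(0)<\xi(0)<\overline g(0)$. Input-output form: with $p=d/dt$, $Q(p)=\det(pI-A)$, $R(p)=L(pI-A)^*B$ (where $(pI-A)^*$ is the adjugate matrix) and $\bar Q(p)=Q(p)-kR(p)$, the plant is written as $Q(p)y=R(p)u+\phi$, where $\phi$ collects the contribution of initial conditions and disturbance (in the paper, $\phi(t)=L(pI-A)^*[x(0)+Df(t)+Bu(0)+Bf(0)]$). With $u_1=ky$ it becomes $\bar Q(p)y=R(p)u_2+\phi$. The symbol $\frac{pR(p)}{\bar Q(p)}u_2$ denotes the output of the linear time-invariant system with (proper) transfer function $sR(s)/\bar Q(s)$, zero initial conditions and input $u_2$. One sets $\bar\phi=\frac{p}{\bar Q(p)}\phi$, so that $$\dot y=\frac{pR(p)}{\bar Q(p)}u_2+\bar\phi ,$$ i.e. $\bar\phi$ is the part of $\dot y$ due to the initial state and the disturbance in the system $\dot x=\bar Ax+Bu_2+Df$, $y=Lx$: $\bar\phi(t)=L\bar Ae^{\bar At}x(0)+L\bar A\int_0^te^{\bar A(t-s)}Df(s)\,ds+LDf(t)$. It is a bounded function, and $\hat\phi=\sup_{t\ge0}|\bar\phi(t)|$. Notation: $M>0$ for a matrix means symmetric positive definite; $M\le0$ and $M\ge N$ are in the sense of quadratic forms of symmetric matrices; $*$ denotes blocks determined by symmetry; $\mathrm{sign}$ is the sign function.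
   Formalization: In the law for u_2, sign(u_2) takes a fixed value +1 or −1 at u_2=0 instead of 0; with sign(0)=0 the claim fails, since u_2≡0 is then a solution and ξ can fall below the lower bound. *)

theory Defs
  imports "HOL-Analysis.Analysis" "HOL-Computational_Algebra.Polynomial"
begin

text \<open>
  Column matrices in \<open>\<real>\<^bsup>n\<times>1\<^esup>\<close> and row matrices in \<open>\<real>\<^bsup>1\<times>n\<^esup>\<close> are
  both represented by vectors \<open>real ^ 'n\<close>; a product column times row becomes \<open>outer\<close>, and a
  product row times column becomes the inner product.
\<close>

definition outer :: "real ^ 'n \<Rightarrow> real ^ 'n \<Rightarrow> real ^ 'n ^ 'n" where
  "outer a b = (\<chi> i j. a $ i * b $ j)"


subsection \<open>Matrix inequalities\<close>

definition symmetric_mat :: "real ^ 'n ^ 'n \<Rightarrow> bool" where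
  "symmetric_mat M \<longleftrightarrow> transpose M = M"

definition pos_def :: "real ^ 'n ^ 'n \<Rightarrow> bool" where
  "pos_def M \<longleftrightarrow> symmetric_mat M \<and> (\<forall>v. v \<noteq> 0 \<longrightarrow> 0 < v \<bullet> (M *v v))"

definition neg_semidef :: "real ^ 'n ^ 'n \<Rightarrow> bool" where
  "neg_semidef M \<longleftrightarrow> symmetric_mat M \<and> (\<forall>v. v \<bullet> (M *v v) \<le> 0)"

definition mat_ge :: "real ^ 'n ^ 'n \<Rightarrow> real ^ 'n ^ 'n \<Rightarrow> bool" where
  "mat_ge M N \<longleftrightarrow> symmetric_mat M \<and> symmetric_mat N \<and> (\<forall>v. v \<bullet> (N *v v) \<le> v \<bullet> (M *v v))"

text \<open>The block matrix with rows \<open>[P, Q]\<close> and \<open>[Q\<^sup>T, S]\<close>.\<close>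

definition sym_block ::
  "real ^ 'a ^ 'a \<Rightarrow> real ^ 'b ^ 'a \<Rightarrow> real ^ 'b ^ 'b \<Rightarrow> real ^ ('a + 'b) ^ ('a + 'b)" where
  "sym_block P Q S = (\<chi> i j.
     case i of
       Inl a \<Rightarrow> (case j of Inl a' \<Rightarrow> P $ a $ a' | Inr b \<Rightarrow> Q $ a $ b)
     | Inr b \<Rightarrow> (case j of Inl a \<Rightarrow> Q $ a $ b | Inr b' \<Rightarrow> S $ b $ b'))"

definition two_columns :: "real ^ 'n \<Rightarrow> real ^ 'n \<Rightarrow> real ^ 2 ^ 'n" where
  "two_columns a b = transpose (vector [a, b])"


subsection \<open>Input-output description of the plant\<close>

definition char_matrix :: "real ^ 'n ^ 'n \<Rightarrow> real poly ^ 'n ^ 'n" where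
  "char_matrix A = (\<chi> i j. (if i = j then [:0, 1:] else 0) - [:A $ i $ j:])"

text \<open>
  Entry \<open>(i, j)\<close> of the adjugate is the cofactor of entry \<open>(j, i)\<close>, that is, the determinant
  after row \<open>j\<close> has been replaced by the \<open>i\<close>-th unit row.
\<close>

definition adjugate :: "'a::comm_ring_1 ^ 'n ^ 'n \<Rightarrow> 'a ^ 'n ^ 'n" where
  "adjugate M = (\<chi> i j. det (\<chi> k. if k = j then axis i 1 else M $ k))"

definition Q_poly :: "real ^ 'n ^ 'n \<Rightarrow> real poly" where
  "Q_poly A = det (char_matrix A)"

definition R_poly :: "real ^ 'n ^ 'n \<Rightarrow> real ^ 'n \<Rightarrow> real ^ 'n \<Rightarrow> real poly" where
  "R_poly A B L = (\<Sum>i\<in>UNIV. \<Sum>j\<in>UNIV. [:L $ i:] * adjugate (char_matrix A) $ i $ j * [:B $ j:])"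

definition hurwitz :: "real poly \<Rightarrow> bool" where
  "hurwitz p \<longleftrightarrow> (\<forall>z::complex. poly (map_poly complex_of_real p) z = 0 \<longrightarrow> Re z < 0)"

definition time_interval :: "ereal \<Rightarrow> real set" where
  "time_interval T = {t. 0 \<le> t \<and> ereal t < T}"

text \<open>
  \<open>w = (N(p) / M(p)) v\<close> on \<open>[0, T)\<close> with zero initial conditions, for a proper transfer function
  \<open>N(s) / M(s)\<close>: \<open>w = N(p) \<zeta>\<close>, where \<open>M(p) \<zeta> = v\<close> and \<open>\<zeta>\<close> together with its first
  \<open>degree M - 1\<close> derivatives vanishes at \<open>0\<close>.  Here \<open>\<zeta> i\<close> stands for the \<open>i\<close>-th derivative
  of \<open>\<zeta>\<close>.
\<close>

definition lti_output ::
  "real poly \<Rightarrow> real poly \<Rightarrow> ereal \<Rightarrow> (real \<Rightarrow> real) \<Rightarrow> (real \<Rightarrow> real) \<Rightarrow> bool" where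
  "lti_output N M T v w \<longleftrightarrow>
     M \<noteq> 0 \<and> degree N \<le> degree M \<and>
     (\<exists>\<zeta> :: nat \<Rightarrow> real \<Rightarrow> real.
        (\<forall>i < degree M. \<zeta> i 0 = 0) \<and>
        (\<forall>i < degree M. \<forall>t \<in> time_interval T.
            (\<zeta> i has_real_derivative \<zeta> (Suc i) t) (at t within time_interval T)) \<and>
        (\<forall>t \<in> time_interval T. (\<Sum>i\<le>degree M. coeff M i * \<zeta> i t) = v t) \<and>
        (\<forall>t \<in> time_interval T. w t = (\<Sum>i\<le>degree M. coeff N i * \<zeta> i t)))"

definition mat_exp :: "real ^ 'n ^ 'n \<Rightarrow> real ^ 'n ^ 'n" where
  "mat_exp M = (\<Sum>i. (1 / fact i) *\<^sub>R (((**) M ^^ i) (mat 1)))"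

text \<open>The part of \<open>dy/dt\<close> caused by the initial state and the disturbance.\<close>

definition phi_bar ::
  "real ^ 'n ^ 'n \<Rightarrow> real ^ 'n \<Rightarrow> real ^ 'n \<Rightarrow> real ^ 'n \<Rightarrow> (real \<Rightarrow> real) \<Rightarrow> real \<Rightarrow> real" where
  "phi_bar Abar D L x0 f t =
     L \<bullet> (Abar *v (mat_exp (t *\<^sub>R Abar) *v x0))
     + L \<bullet> (Abar *v integral {0..t} (\<lambda>s. mat_exp ((t - s) *\<^sub>R Abar) *v (f s *\<^sub>R D)))
     + (L \<bullet> D) * f t"

definition stabilizable :: "real ^ 'n ^ 'n \<Rightarrow> real ^ 'n \<Rightarrow> bool" where
  "stabilizable A B \<longleftrightarrow> (\<exists>K. hurwitz (Q_poly (A + outer B K)))"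

definition observable :: "real ^ 'n ^ 'n \<Rightarrow> real ^ 'n \<Rightarrow> bool" where
  "observable A L \<longleftrightarrow> (\<forall>x0. (\<forall>t\<ge>0. L \<bullet> (mat_exp (t *\<^sub>R A) *v x0) = 0) \<longrightarrow> x0 = 0)"


subsection \<open>Signals and the change of variable\<close>

definition piecewise_cont :: "(real \<Rightarrow> real) \<Rightarrow> bool" where
  "piecewise_cont f \<longleftrightarrow>
     (\<forall>b>0. \<exists>S. finite S \<and> continuous_on ({0..b} - S) f) \<and>
     (\<forall>t>0. \<exists>l. (f \<longlongrightarrow> l) (at_left t)) \<and>
     (\<forall>t\<ge>0. \<exists>l. (f \<longlongrightarrow> l) (at_right t))"

definition C1_nonneg :: "(real \<Rightarrow> real) \<Rightarrow> bool" where
  "C1_nonneg g \<longleftrightarrow>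
     (\<exists>g'. (\<forall>t\<ge>0. (g has_real_derivative g' t) (at t within {0..})) \<and> continuous_on {0..} g')"

text \<open>\<open>\<Phi>\<close> is continuously differentiable on \<open>\<real> \<times> [0, \<infinity>)\<close> with partial derivatives
  \<open>\<Phi>\<^sub>\<epsilon>\<close> and \<open>\<Phi>\<^sub>t\<close>.\<close>

definition C1_with_partials ::
  "(real \<Rightarrow> real \<Rightarrow> real) \<Rightarrow> (real \<Rightarrow> real \<Rightarrow> real) \<Rightarrow> (real \<Rightarrow> real \<Rightarrow> real) \<Rightarrow> bool" where
  "C1_with_partials \<Phi> \<Phi>\<^sub>\<epsilon> \<Phi>\<^sub>t \<longleftrightarrow>
     (\<forall>e. \<forall>t\<ge>0. ((\<lambda>e. \<Phi> e t) has_real_derivative \<Phi>\<^sub>\<epsilon> e t) (at e)) \<and>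
     (\<forall>e. \<forall>t\<ge>0. ((\<lambda>t. \<Phi> e t) has_real_derivative \<Phi>\<^sub>t e t) (at t within {0..})) \<and>
     continuous_on (UNIV \<times> {0..}) (\<lambda>(e, t). \<Phi>\<^sub>\<epsilon> e t) \<and>
     continuous_on (UNIV \<times> {0..}) (\<lambda>(e, t). \<Phi>\<^sub>t e t)"

definition inverse_map :: "(real \<Rightarrow> real \<Rightarrow> real) \<Rightarrow> real \<Rightarrow> real \<Rightarrow> real" where
  "inverse_map \<Phi> \<xi> t = (THE e. \<Phi> e t = \<xi>)"


subsection \<open>The control law\<close>

text \<open>
  The sign function with value \<open>\<sigma>\<close> at \<open>0\<close>.  For the factor \<open>sign(u\<^sub>2)\<close> of the control law we
  need \<open>\<bar>\<sigma>\<bar> = 1\<close>: the law is designed so that \<open>2 p\<^sub>3 (\<bar>u\<^sub>2\<bar> + \<delta>) sign(u\<^sub>2) du\<^sub>2/dt\<close> equals minus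
  the bracket, which uses \<open>sign(u\<^sub>2)\<^sup>2 = 1\<close>.  With \<open>sgn 0 = 0\<close> the constant \<open>u\<^sub>2 = 0\<close> would
  always be a solution, and \<open>\<xi>\<close> would then not be controlled at all.
\<close>

definition sign_at0 :: "real \<Rightarrow> real \<Rightarrow> real" where
  "sign_at0 \<sigma> z = (if z = 0 then \<sigma> else sgn z)"

text \<open>The right-hand side of the equation for \<open>u\<^sub>2\<close> in terms of the current values of \<open>u\<^sub>2\<close>,
  \<open>\<epsilon>\<close>, \<open>y\<close> and of the output \<open>w\<close> of the filter \<open>p R(p) / (Q(p) - k R(p))\<close> driven by \<open>u\<^sub>2\<close>.\<close>

definition u2_rhs ::
  "real \<Rightarrow> real \<Rightarrow> real \<Rightarrow> real \<Rightarrow> real \<Rightarrow> real \<Rightarrow> real \<Rightarrow> real \<Rightarrow> real \<Rightarrow> real \<Rightarrow> real" where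
  "u2_rhs \<sigma> p3 \<delta> \<alpha> p1bar \<mu> u2 \<epsilon> y w =
     - (1 / (2 * p3 * (\<bar>u2\<bar> + \<delta>))) * sign_at0 \<sigma> u2 *
       (\<alpha> * \<epsilon> + 2 * p1bar * y * w + \<mu> * p1bar\<^sup>2 * sgn \<epsilon> * y\<^sup>2)"

text \<open>
  Closed-loop trajectories on \<open>[0, T)\<close>, \<open>T \<le> \<infinity>\<close>, in the sense of Caratheodory (integral
  equations; the right-hand sides are discontinuous in time and in the state).  The plant equation
  holds on all of \<open>[0, T)\<close>.  The control law involves \<open>\<epsilon> = \<Phi>\<^sup>-\<^sup>1(\<xi>, t)\<close>, which exists
  only if \<open>g\<^sub>l t < \<xi> t < g\<^sub>u t\<close>; it is therefore imposed only up to times \<open>t\<close> such that these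
  inequalities have held on \<open>[0, t]\<close>.  That they never cease to hold is not assumed.
\<close>

definition plant_trajectory ::
  "real ^ 'n ^ 'n \<Rightarrow> real ^ 'n \<Rightarrow> real ^ 'n \<Rightarrow> (real \<Rightarrow> real) \<Rightarrow> ereal \<Rightarrow>
   (real \<Rightarrow> real ^ 'n) \<Rightarrow> (real \<Rightarrow> real) \<Rightarrow> bool" where
  "plant_trajectory A B D f T x u \<longleftrightarrow>
     continuous_on (time_interval T) x \<and>
     (\<forall>t \<in> time_interval T.
        ((\<lambda>s. A *v x s + u s *\<^sub>R B + f s *\<^sub>R D) has_integral (x t - x 0)) {0..t})"

definition follows_u2_law ::
  "real \<Rightarrow> real \<Rightarrow> real \<Rightarrow> real \<Rightarrow> real \<Rightarrow> real \<Rightarrow>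
   (real \<Rightarrow> real \<Rightarrow> real) \<Rightarrow> (real \<Rightarrow> real) \<Rightarrow> (real \<Rightarrow> real) \<Rightarrow> ereal \<Rightarrow>
   (real \<Rightarrow> real) \<Rightarrow> (real \<Rightarrow> real) \<Rightarrow> (real \<Rightarrow> real) \<Rightarrow> (real \<Rightarrow> real) \<Rightarrow> bool" where
  "follows_u2_law \<sigma> p3 \<delta> \<alpha> p1bar \<mu> \<Phi> gl gu T \<xi> y w u2 \<longleftrightarrow>
     continuous_on (time_interval T) u2 \<and>
     (\<forall>t \<in> time_interval T. (\<forall>s \<in> {0..t}. gl s < \<xi> s \<and> \<xi> s < gu s) \<longrightarrow>
        ((\<lambda>s. u2_rhs \<sigma> p3 \<delta> \<alpha> p1bar \<mu> (u2 s) (inverse_map \<Phi> (\<xi> s) s) (y s) (w s))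
          has_integral (u2 t - u2 0)) {0..t})"

end

theory Submission
  imports Defs
begin

text \<open>
  Write \<open>\<phi>\<close> for \<open>phi_bar\<close> and \<open>q\<close> for \<open>p1bar\<close>.  The output satisfies \<open>dy/dt = w + \<phi>\<close>, where \<open>w\<close> is the
  filter output used by the controller, and the control law is built so that \<open>w\<close> cancels from the
  derivative of \<open>\<xi>\<close>:
  \<open>d\<xi>/dt = 2 q y \<phi> - \<alpha> \<epsilon> - \<mu> q\<^sup>2 sgn \<epsilon> y\<^sup>2\<close>.
  By Young's inequality \<open>2 \<bar>q y \<phi>\<bar> \<le> \<mu> q\<^sup>2 y\<^sup>2 + phihat\<^sup>2 / \<mu>\<close>, so the last term absorbs every
  occurrence of \<open>y\<close>, and \<open>- \<alpha> \<epsilon>\<close> dominates the rest once \<open>\<bar>\<epsilon>\<bar>\<close> is large.  For a large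
  constant \<open>K\<close> the curves \<open>t \<mapsto> \<Phi> (\<plusminus>K) t\<close> are therefore barriers: they move with speed at most \<open>\<gamma>\<close>,
  while \<open>\<xi>\<close> close to them moves inwards with speed at least \<open>\<gamma> + \<alpha>\<close>.  Hence \<open>\<xi>\<close> never reaches them
  (\<open>first_zero\<close>, \<open>no_contact\<close>), and they lie strictly between \<open>gl\<close> and \<open>gu\<close>.  Comparing \<open>\<xi>\<close> with
  barriers rather than following \<open>\<epsilon>\<close> makes it unnecessary to differentiate the inverse of \<open>\<Phi>\<close>.

  Two points need work.  The controller sees the filter only as a transfer function, so
  \<open>dy/dt = w + \<phi>\<close> requires a state realization of \<open>p R(p) / (Q(p) - k R(p))\<close>, obtained from the adjugate
  of \<open>p I - A\<close> (\<open>lti_output_realization\<close>), and the variation of constants formula for the remaining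
  part of the state (\<open>variation_of_constants\<close>); they combine to \<open>output_derivative\<close>.  Moreover the
  trajectories solve integral equations with discontinuous right-hand sides, and \<open>\<bar>u\<^sub>2\<bar>\<close> is not
  smooth.  The formula for \<open>d\<xi>/dt\<close> is therefore an integral identity (\<open>energy_balance\<close>), which rests on
  \<open>integral_chain_rule\<close> and \<open>has_integral_abs_sign\<close>.
\<close>

section \<open>A state realization of the filter\<close>

text \<open>
  The sum is the determinant of \<open>M\<close> with row \<open>l\<close> replaced by row \<open>i\<close>, because the determinant is
  linear in row \<open>l\<close>; for \<open>i \<noteq> l\<close> that matrix has two equal rows.  Stated over a commutative ring, so
  that it covers matrices of polynomials.
\<close>

lemma matrix_mult_adjugate:
  fixes M :: "'a::comm_ring_1 ^ 'n ^ 'n"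
  shows "(\<Sum>j\<in>UNIV. M $ i $ j * adjugate M $ j $ l) = (if i = l then det M else 0)"
proof -
  have "(\<Sum>j\<in>UNIV. M $ i $ j * adjugate M $ j $ l)
      = (\<Sum>j\<in>UNIV. det (\<chi> k. if k = l then M $ i $ j *s axis j 1 else M $ k))"
    by (simp add: adjugate_def det_row_mul)
  also have "\<dots> = det (\<chi> k. if k = l then (\<Sum>j\<in>UNIV. M $ i $ j *s axis j 1) else M $ k)"
    by (rule det_linear_row_sum [symmetric]) simp
  also have "(\<Sum>j\<in>UNIV. M $ i $ j *s axis j 1) = M $ i"
    by (simp add: vec_eq_iff axis_def if_distrib cong: if_cong)
  also have "det (\<chi> k. if k = l then M $ i else M $ k) = (if i = l then det M else 0)"
  proof (cases "i = l")
    case True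
    then have "(\<chi> k. if k = l then M $ i else M $ k) = M" by vector
    then show ?thesis using True by simp
  next
    case False
    then show ?thesis by (auto intro!: det_identical_rows [of i l] simp: row_def)
  qed
  finally show ?thesis .
qed

text \<open>The vector \<open>(p I - A)\<^sup>* B\<close>, which turns the internal variable \<open>\<zeta>\<close> of the filter into a state.\<close>

definition state_poly :: "real ^ 'n ^ 'n \<Rightarrow> real ^ 'n \<Rightarrow> 'n \<Rightarrow> real poly" where
  "state_poly A B i = (\<Sum>j\<in>UNIV. adjugate (char_matrix A) $ i $ j * [:B $ j:])"

lemma state_poly_identity:
  "[:0, 1:] * state_poly A B i - (\<Sum>j\<in>UNIV. [:A $ i $ j:] * state_poly A B j) = Q_poly A * [:B $ i:]"
proof -
  have "(\<Sum>j\<in>UNIV. char_matrix A $ i $ j * state_poly A B j)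
      = (\<Sum>l\<in>UNIV. (\<Sum>j\<in>UNIV. char_matrix A $ i $ j * adjugate (char_matrix A) $ j $ l) * [:B $ l:])"
    unfolding state_poly_def sum_distrib_left sum_distrib_right
    by (subst sum.swap) (simp only: mult.assoc)
  also have "\<dots> = Q_poly A * [:B $ i:]"
    by (simp only: matrix_mult_adjugate Q_poly_def if_distrib [where f = "\<lambda>x. x * _"]
        mult_zero_left sum.delta sum.delta' finite UNIV_I if_True cong: if_cong)
  also have "(\<Sum>j\<in>UNIV. char_matrix A $ i $ j * state_poly A B j)
      = (\<Sum>j\<in>UNIV. (if i = j then [:0, 1:] * state_poly A B j else 0) - [:A $ i $ j:] * state_poly A B j)"
    by (rule sum.cong) (auto simp: char_matrix_def left_diff_distrib)
  also have "\<dots> = [:0, 1:] * state_poly A B i - (\<Sum>j\<in>UNIV. [:A $ i $ j:] * state_poly A B j)"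
    by (simp only: sum_subtractf sum.delta sum.delta' finite UNIV_I if_True)
  finally show ?thesis .
qed

lemma R_poly_eq: "R_poly A B L = (\<Sum>i\<in>UNIV. [:L $ i:] * state_poly A B i)"
  unfolding R_poly_def state_poly_def sum_distrib_left by (simp only: mult.assoc)

text \<open>
  Feeding back \<open>k y\<close> perturbs \<open>p I - A\<close> by the rank-one matrix \<open>k B L\<close>, which maps \<open>(p I - A)\<^sup>* B\<close> to
  \<open>k R(p) B\<close>.  Hence \<open>(p I - A)\<^sup>* B\<close> also inverts the closed loop, with \<open>Q - k R\<close> in place of \<open>Q\<close>,
  and the determinant of \<open>p I - A - k B L\<close> never has to be computed.
\<close>

lemma closed_loop_state_poly_identity:
  "[:0, 1:] * state_poly A B i
      - (\<Sum>j\<in>UNIV. [:(A + k *\<^sub>R outer B L) $ i $ j:] * state_poly A B j)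
    = (Q_poly A - [:k:] * R_poly A B L) * [:B $ i:]"
proof -
  have "[:(A + k *\<^sub>R outer B L) $ i $ j:]
      = [:A $ i $ j:] + [:k:] * [:B $ i:] * [:L $ j:]" for j
    by (simp add: outer_def)
  then have "(\<Sum>j\<in>UNIV. [:(A + k *\<^sub>R outer B L) $ i $ j:] * state_poly A B j)
      = (\<Sum>j\<in>UNIV. [:A $ i $ j:] * state_poly A B j) + [:k:] * [:B $ i:] * R_poly A B L"
    unfolding R_poly_eq by (simp only: distrib_right sum.distrib sum_distrib_left mult.assoc)
  moreover have "p - s = q * b \<Longrightarrow> s' = s + c * b * r \<Longrightarrow> p - s' = (q - c * r) * b" for p q r s s' b c :: "real poly"
    by (simp only: left_diff_distrib right_diff_distrib mult.assoc mult.left_commute mult.commute diff_diff_eq [symmetric])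
  ultimately show ?thesis using state_poly_identity [of A B i] by blast
qed

definition state_coeff :: "real ^ 'n ^ 'n \<Rightarrow> real ^ 'n \<Rightarrow> nat \<Rightarrow> real ^ 'n" where
  "state_coeff A B m = (\<chi> i. coeff (state_poly A B i) m)"

context
  fixes A Abar :: "real ^ 'n ^ 'n" and B L :: "real ^ 'n" and k :: real
  assumes Abar: "Abar = A + k *\<^sub>R outer B L"
begin

lemma state_coeff_0:
  "- (Abar *v state_coeff A B 0) = coeff (Q_poly A - [:k:] * R_poly A B L) 0 *\<^sub>R B"
proof (subst vec_eq_iff, rule allI)
  fix i
  have "coeff ([:0, 1:] * state_poly A B i
      - (\<Sum>j\<in>UNIV. [:Abar $ i $ j:] * state_poly A B j)) 0 = coeff ((Q_poly A - [:k:] * R_poly A B L) * [:B $ i:]) 0"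
    unfolding Abar closed_loop_state_poly_identity ..
  then show "(- (Abar *v state_coeff A B 0)) $ i = (coeff (Q_poly A - [:k:] * R_poly A B L) 0 *\<^sub>R B) $ i"
    by (simp add: state_coeff_def matrix_vector_mult_def coeff_sum)
qed

lemma state_coeff_Suc:
  "state_coeff A B m - Abar *v state_coeff A B (Suc m) = coeff (Q_poly A - [:k:] * R_poly A B L) (Suc m) *\<^sub>R B"
proof (subst vec_eq_iff, rule allI)
  fix i
  have "coeff ([:0, 1:] * state_poly A B i
      - (\<Sum>j\<in>UNIV. [:Abar $ i $ j:] * state_poly A B j)) (Suc m) = coeff ((Q_poly A - [:k:] * R_poly A B L) * [:B $ i:]) (Suc m)"
    unfolding Abar closed_loop_state_poly_identity ..
  then show "(state_coeff A B m - Abar *v state_coeff A B (Suc m)) $ i = (coeff (Q_poly A - [:k:] * R_poly A B L) (Suc m) *\<^sub>R B) $ i"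
    by (simp add: state_coeff_def matrix_vector_mult_def coeff_sum coeff_pCons mult.commute [of "B $ i"])
qed

text \<open>
  The recursion \<open>state_coeff_Suc\<close> shows that \<open>(p I - A)\<^sup>* B\<close> has smaller degree than \<open>Q - k R\<close>:
  otherwise its leading coefficient would be a nonzero coefficient of \<open>(Q - k R) B\<close> of too high an order.
  Only derivatives of \<open>\<zeta>\<close> with prescribed initial value \<open>0\<close> therefore enter the state.
\<close>

lemma state_coeff_eq_0:
  assumes "degree (Q_poly A - [:k:] * R_poly A B L) \<le> m"
  shows "state_coeff A B m = 0"
proof -
  define b where "b = m + (\<Sum>i\<in>UNIV. Suc (degree (state_poly A B i)))"
  have "state_coeff A B b = 0"
  proof (subst vec_eq_iff, rule allI)
    fix i
    have "Suc (degree (state_poly A B i)) \<le> (\<Sum>i\<in>UNIV. Suc (degree (state_poly A B i)))"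
      by (rule member_le_sum) auto
    then show "state_coeff A B b $ i = 0 $ i"
      by (simp add: b_def state_coeff_def coeff_eq_0)
  qed
  have "m \<le> b" by (simp add: b_def)
  then show ?thesis
  proof (induction rule: inc_induct)
    case base
    show ?case by fact
  next
    case (step l)
    then have "state_coeff A B (Suc l) = 0" by simp
    moreover have "coeff (Q_poly A - [:k:] * R_poly A B L) (Suc l) = 0"
      using step assms by (intro coeff_eq_0) simp
    ultimately show ?case using state_coeff_Suc [of l] by simp
  qed
qed

text \<open>
  The state is \<open>X = (p I - A)\<^sup>* B \<zeta>\<close> with \<open>(Q - k R)(p) \<zeta> = v\<close>, and the filter output is
  \<open>p R(p) \<zeta> = L dX/dt\<close>.
\<close>

lemma lti_output_realization:
  assumes lti: "lti_output ([:0, 1:] * R_poly A B L) (Q_poly A - [:k:] * R_poly A B L) T v w"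
  obtains X where "X 0 = 0"
    "\<And>t. t \<in> time_interval T \<Longrightarrow>
      (X has_vector_derivative (Abar *v X t + v t *\<^sub>R B)) (at t within time_interval T)"
    "\<And>t. t \<in> time_interval T \<Longrightarrow> w t = L \<bullet> (Abar *v X t + v t *\<^sub>R B)"
proof -
  define M where "M = Q_poly A - [:k:] * R_poly A B L"
  define d where "d = degree M"
  define N where "N = state_coeff A B"
  obtain \<zeta> :: "nat \<Rightarrow> real \<Rightarrow> real" where
    z0: "\<And>i. i < d \<Longrightarrow> \<zeta> i 0 = 0"
    and dz: "\<And>i t. i < d \<Longrightarrow> t \<in> time_interval T \<Longrightarrow>
      (\<zeta> i has_real_derivative \<zeta> (Suc i) t) (at t within time_interval T)"
    and inp: "\<And>t. t \<in> time_interval T \<Longrightarrow> (\<Sum>i\<le>d. coeff M i * \<zeta> i t) = v t"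
    and out: "\<And>t. t \<in> time_interval T \<Longrightarrow> w t = (\<Sum>i\<le>d. coeff ([:0, 1:] * R_poly A B L) i * \<zeta> i t)"
    using lti unfolding lti_output_def M_def [symmetric] d_def [symmetric] by blast
  define X where "X t = (\<Sum>m<d. \<zeta> m t *\<^sub>R N m)" for t
  have Nd: "N d = 0" unfolding N_def by (rule state_coeff_eq_0) (simp add: d_def M_def)
  have rhs: "Abar *v X t + v t *\<^sub>R B = (\<Sum>m<d. \<zeta> (Suc m) t *\<^sub>R N m)" if t: "t \<in> time_interval T" for t
  proof -
    have "v t *\<^sub>R B = (\<Sum>i\<le>d. \<zeta> i t *\<^sub>R (coeff M i *\<^sub>R B))"
      unfolding inp [OF t, symmetric] by (simp add: scaleR_sum_left mult.commute)
    also have "\<dots> = \<zeta> 0 t *\<^sub>R (coeff M 0 *\<^sub>R B) + (\<Sum>i<d. \<zeta> (Suc i) t *\<^sub>R (coeff M (Suc i) *\<^sub>R B))"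
      by (simp only: lessThan_Suc_atMost [symmetric] sum.lessThan_Suc_shift o_def)
    also have "\<dots> = - (\<zeta> 0 t *\<^sub>R (Abar *v N 0)) + (\<Sum>i<d. \<zeta> (Suc i) t *\<^sub>R (N i - Abar *v N (Suc i)))"
      unfolding M_def N_def state_coeff_0 [symmetric] state_coeff_Suc [symmetric] by simp
    \<comment> \<open>The terms with \<open>Abar\<close> recombine to \<open>Abar *v X t\<close>; the extra summand of index \<open>d\<close> is zero.\<close>
    also have "\<dots> = (\<Sum>i<d. \<zeta> (Suc i) t *\<^sub>R N i)
        - (\<zeta> 0 t *\<^sub>R (Abar *v N 0) + (\<Sum>i<d. \<zeta> (Suc i) t *\<^sub>R (Abar *v N (Suc i))))"
      by (simp add: scaleR_diff_right sum_subtractf)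
    also have "\<zeta> 0 t *\<^sub>R (Abar *v N 0) + (\<Sum>i<d. \<zeta> (Suc i) t *\<^sub>R (Abar *v N (Suc i)))
        = (\<Sum>i<Suc d. \<zeta> i t *\<^sub>R (Abar *v N i))"
      by (simp only: sum.lessThan_Suc_shift o_def)
    also have "\<dots> = Abar *v X t"
      using Nd by (simp add: X_def matrix_vector_mult_scaleR linear_sum [OF matrix_vector_mul_linear])
    finally show ?thesis by simp
  qed
  show ?thesis
  proof (rule that [of X])
    show "X 0 = 0" by (simp add: X_def z0)
    fix t assume t: "t \<in> time_interval T"
    show "(X has_vector_derivative (Abar *v X t + v t *\<^sub>R B)) (at t within time_interval T)"
      unfolding rhs [OF t] unfolding X_def [abs_def]
    proof (rule has_vector_derivative_sum)
      fix m assume "m \<in> {..<d}"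
      then have "m < d" by simp
      from has_vector_derivative_scaleR [OF dz [OF this t] has_vector_derivative_const [of "N m"]]
      show "((\<lambda>t. \<zeta> m t *\<^sub>R N m) has_vector_derivative \<zeta> (Suc m) t *\<^sub>R N m)
          (at t within time_interval T)" by simp
    qed
    have R: "coeff (R_poly A B L) m = L \<bullet> N m" for m
      by (simp add: R_poly_eq N_def state_coeff_def coeff_sum inner_vec_def)
    have "w t = (\<Sum>i<Suc d. coeff ([:0, 1:] * R_poly A B L) i * \<zeta> i t)"
      using out [OF t] by (simp add: lessThan_Suc_atMost)
    also have "\<dots> = (\<Sum>i<d. coeff (R_poly A B L) i * \<zeta> (Suc i) t)"
      by (subst sum.lessThan_Suc_shift) (simp add: coeff_pCons)
    also have "\<dots> = L \<bullet> (Abar *v X t + v t *\<^sub>R B)"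
      unfolding rhs [OF t] R by (simp add: inner_sum_right mult.commute)
    finally show "w t = L \<bullet> (Abar *v X t + v t *\<^sub>R B)" .
  qed
qed

end

section \<open>The matrix exponential and variation of constants\<close>

definition mat_pow :: "real ^ 'n ^ 'n \<Rightarrow> nat \<Rightarrow> real ^ 'n ^ 'n" where
  "mat_pow M n = ((**) M ^^ n) (mat 1)"

lemma mat_pow_simps [simp]: "mat_pow M 0 = mat 1" "mat_pow M (Suc n) = M ** mat_pow M n"
  by (simp_all add: mat_pow_def)

lemma mat_pow_Suc_right: "mat_pow M (Suc n) = mat_pow M n ** M"
  by (induction n) (simp_all add: matrix_mul_assoc)

lemma mat_pow_scaleR: "mat_pow (t *\<^sub>R M) n = t ^ n *\<^sub>R mat_pow M n"
  by (induction n)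
    (simp_all add: vec_eq_iff matrix_matrix_mult_def sum_distrib_left mult.assoc mult.left_commute)

text \<open>
  The entries of \<open>mat_exp (t *\<^sub>R M)\<close> are real power series in \<open>t\<close>; this bound makes them converge
  everywhere, so that they can be differentiated term by term.
\<close>

lemma abs_mat_pow_le: "\<bar>mat_pow M n $ i $ j\<bar> \<le> (\<Sum>i\<in>UNIV. \<Sum>k\<in>UNIV. \<bar>M $ i $ k\<bar>) ^ n"
proof (induction n arbitrary: i)
  case (Suc n)
  let ?c = "\<Sum>i\<in>UNIV. \<Sum>k\<in>UNIV. \<bar>M $ i $ k\<bar>"
  have "\<bar>mat_pow M (Suc n) $ i $ j\<bar> \<le> (\<Sum>k\<in>UNIV. \<bar>M $ i $ k * mat_pow M n $ k $ j\<bar>)"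
    by (simp add: matrix_matrix_mult_def)
  also have "\<dots> \<le> (\<Sum>k\<in>UNIV. \<bar>M $ i $ k\<bar> * ?c ^ n)"
    unfolding abs_mult by (intro sum_mono mult_left_mono Suc.IH) simp
  also have "\<dots> = (\<Sum>k\<in>UNIV. \<bar>M $ i $ k\<bar>) * ?c ^ n"
    by (simp add: sum_distrib_right)
  also have "\<dots> \<le> ?c * ?c ^ n"
    by (intro mult_right_mono member_le_sum zero_le_power sum_nonneg) auto
  finally show ?case by simp
qed (simp add: mat_def)

lemma summable_mat_exp_entry: "summable (\<lambda>n. mat_pow M n $ i $ j / fact n * t ^ n)"
proof -
  define c where "c = (\<Sum>i\<in>UNIV. \<Sum>k\<in>UNIV. \<bar>M $ i $ k\<bar>)"
  have "\<bar>mat_pow M n $ i $ j / fact n * t ^ n\<bar> \<le> inverse (fact n) * (c * \<bar>t\<bar>) ^ n" for n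
    using abs_mat_pow_le [of M n i j]
    by (simp add: c_def abs_mult power_mult_distrib power_abs divide_inverse mult_left_mono mult_right_mono mult.commute mult.left_commute)
  then show ?thesis
    by (intro summable_comparison_test' [OF summable_exp [of "c * \<bar>t\<bar>"], of 0]) simp
qed

lemma mat_exp_entry: "mat_exp (t *\<^sub>R M) $ i $ j = (\<Sum>n. mat_pow M n $ i $ j / fact n * t ^ n)"
proof -
  let ?E = "\<chi> i j. \<Sum>n. mat_pow M n $ i $ j / fact n * t ^ n"
  have "(\<lambda>n. (1 / fact n) *\<^sub>R mat_pow (t *\<^sub>R M) n) sums ?E"
    unfolding sums_def
  proof (intro vec_tendstoI)
    fix i j
    have "(\<lambda>n. mat_pow M n $ i $ j / fact n * t ^ n) sums (?E $ i $ j)"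
      using summable_sums [OF summable_mat_exp_entry] by simp
    then show "(\<lambda>m. (\<Sum>n<m. (1 / fact n) *\<^sub>R mat_pow (t *\<^sub>R M) n) $ i $ j) \<longlonglongrightarrow> ?E $ i $ j"
      by (simp add: sums_def mat_pow_scaleR mult.commute)
  qed
  then have "mat_exp (t *\<^sub>R M) = ?E"
    unfolding mat_exp_def mat_pow_def [symmetric] by (rule sums_unique [symmetric])
  then show ?thesis by simp
qed

lemma mat_exp_entry_deriv:
  "((\<lambda>t. mat_exp (t *\<^sub>R M) $ i $ j) has_real_derivative (mat_exp (t *\<^sub>R M) ** M) $ i $ j) (at t)"
proof -
  have "((\<lambda>t. \<Sum>n. mat_pow M n $ i $ j / fact n * t ^ n) has_field_derivative
      (\<Sum>n. diffs (\<lambda>n. mat_pow M n $ i $ j / fact n) n * t ^ n)) (at t)"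
    by (rule termdiffs_strong_converges_everywhere) (rule summable_mat_exp_entry)
  moreover have "diffs (\<lambda>n. mat_pow M n $ i $ j / fact n) n * t ^ n
      = (\<Sum>k\<in>UNIV. mat_pow M n $ i $ k / fact n * t ^ n * M $ k $ j)" for n
    unfolding diffs_def mat_pow_Suc_right
    by (simp add: matrix_matrix_mult_def sum_distrib_left sum_divide_distrib sum_distrib_right mult_ac)
  moreover have "(\<Sum>n. \<Sum>k\<in>UNIV. mat_pow M n $ i $ k / fact n * t ^ n * M $ k $ j)
      = (mat_exp (t *\<^sub>R M) ** M) $ i $ j"
  proof -
    have "(\<Sum>n. \<Sum>k\<in>UNIV. mat_pow M n $ i $ k / fact n * t ^ n * M $ k $ j)
        = (\<Sum>k\<in>UNIV. \<Sum>n. mat_pow M n $ i $ k / fact n * t ^ n * M $ k $ j)"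
      by (rule suminf_sum) (intro summable_mult2 summable_mat_exp_entry)
    then show ?thesis
      unfolding suminf_mult2 [OF summable_mat_exp_entry, symmetric] mat_exp_entry [symmetric]
      by (simp add: matrix_matrix_mult_def)
  qed
  ultimately show ?thesis by (simp add: mat_exp_entry)
qed

lemma mat_exp_0: "mat_exp (0 :: real ^ 'n ^ 'n) = mat 1"
proof -
  have "mat_exp (0 *\<^sub>R (0 :: real ^ 'n ^ 'n)) $ i $ j = mat 1 $ i $ j" for i j
    unfolding mat_exp_entry by (subst powser_zero) simp
  then show ?thesis by (simp add: vec_eq_iff)
qed

text \<open>
  Since \<open>dz/ds = M z + h\<close>, the function \<open>e\<^bsup>(t - s) M\<^esup> z s\<close> has derivative \<open>e\<^bsup>(t - s) M\<^esup> h s\<close> with respect to \<open>s\<close> away from the finitely many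
  discontinuities of \<open>h\<close>, and it is continuous; the fundamental theorem of calculus gives the formula,
  here in each component.
\<close>

lemma variation_of_constants:
  fixes z h :: "real \<Rightarrow> real ^ 'n"
  assumes t: "0 \<le> t" and S: "finite S" and hc: "continuous_on ({0..t} - S) h"
    and zc: "continuous_on {0..t} z"
    and z: "\<And>s. s \<in> {0..t} \<Longrightarrow> ((\<lambda>s. M *v z s + h s) has_integral (z s - z 0)) {0..s}"
  shows "((\<lambda>s. mat_exp ((t - s) *\<^sub>R M) *v h s) has_integral (z t - mat_exp (t *\<^sub>R M) *v z 0)) {0..t}"
proof (rule has_integral_componentwise)
  fix b :: "real ^ 'n" assume "b \<in> Basis"
  then obtain i where b: "b = axis i 1" by (auto simp: Basis_vec_def)
  let ?E = "\<lambda>s. mat_exp ((t - s) *\<^sub>R M)"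
  let ?r = "\<lambda>s. M *v z s + h s"
  have dz: "(z has_vector_derivative ?r s) (at s)" if s: "s \<in> {0<..<t} - S" for s
  proof -
    have op: "open ({0<..<t} - S)" using S by (intro open_Diff finite_imp_closed) auto
    have "continuous_on ({0<..<t} - S) ?r"
      by (intro continuous_intros continuous_on_subset [OF hc] continuous_on_subset [OF zc]
        linear_continuous_on_compose [OF _ matrix_vector_mul_linear]) auto
    then have "continuous (at s) ?r"
      using op s continuous_on_eq_continuous_at by blast
    then have "continuous (at s within ({0..t} - S)) ?r" by (rule continuous_at_imp_continuous_at_within)
    with z [of t] t s S have "((\<lambda>u. integral {0..u} ?r) has_vector_derivative ?r s) (at s within ({0..t} - S))"
      by (intro integral_has_vector_derivative_continuous_at) auto
    then have "((\<lambda>u. integral {0..u} ?r) has_vector_derivative ?r s) (at s within ({0<..<t} - S))"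
      by (rule has_vector_derivative_within_subset) auto
    then have "((\<lambda>u. integral {0..u} ?r) has_vector_derivative ?r s) (at s)"
      by (simp only: at_within_open [OF s op])
    then have "((\<lambda>u. integral {0..u} ?r + z 0) has_vector_derivative ?r s) (at s)"
      by (simp only: has_vector_derivative_add_const)
    then show ?thesis
      by (rule has_vector_derivative_transform_within_open [OF _ op s]) (simp add: integral_unique [OF z])
  qed
  have dE: "((\<lambda>s. ?E s $ i $ j) has_real_derivative - ((?E s ** M) $ i $ j)) (at s)" for s j
  proof -
    have "((\<lambda>s. t - s) has_real_derivative - 1) (at s)"
      by (auto intro!: derivative_eq_intros)
    from DERIV_chain [where f = "\<lambda>t. mat_exp (t *\<^sub>R M) $ i $ j" and g = "\<lambda>s. t - s", OF mat_exp_entry_deriv this]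
    show ?thesis by (simp add: o_def)
  qed
  define q where "q s = (\<Sum>j\<in>UNIV. ?E s $ i $ j * z s $ j)" for s
  have "((\<lambda>s. (?E s *v h s) $ i) has_integral (q t - q 0)) {0..t}"
  proof (rule fundamental_theorem_of_calculus_interior_strong [OF S t])
    fix s assume s: "s \<in> {0<..<t} - S"
    have dzj: "((\<lambda>s. z s $ j) has_real_derivative ?r s $ j) (at s)" for j
      using bounded_linear.has_vector_derivative [OF bounded_linear_vec_nth dz [OF s]]
      by (simp only: has_real_derivative_iff_has_vector_derivative)
    have "(q has_real_derivative (\<Sum>j\<in>UNIV. - ((?E s ** M) $ i $ j) * z s $ j + ?r s $ j * ?E s $ i $ j)) (at s)"
      unfolding q_def [abs_def] by (intro DERIV_sum DERIV_mult dE dzj)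
    moreover have "(\<Sum>j\<in>UNIV. - ((?E s ** M) $ i $ j) * z s $ j + ?r s $ j * ?E s $ i $ j)
        = - ((?E s ** M) *v z s) $ i + (?E s *v ?r s) $ i"
      by (simp add: matrix_vector_mult_def sum.distrib sum_subtractf sum_negf mult.commute)
    moreover have "- ((?E s ** M) *v z s) $ i + (?E s *v ?r s) $ i = (?E s *v h s) $ i"
      by (simp add: matrix_vector_right_distrib matrix_vector_mul_assoc)
    ultimately show "(q has_vector_derivative (?E s *v h s) $ i) (at s)"
      by (simp only: has_real_derivative_iff_has_vector_derivative)
  next
    have "continuous_on {0..t} (\<lambda>s. ?E s $ i $ j)" for j
      by (rule DERIV_continuous_on) (rule has_field_derivative_at_within [OF dE])
    moreover have "continuous_on {0..t} (\<lambda>s. z s $ j)" for j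
      by (intro continuous_intros zc)
    ultimately show "continuous_on {0..t} q"
      unfolding q_def by (intro continuous_on_sum continuous_on_mult)
  qed
  moreover have "q t = z t $ i"
    by (simp add: q_def mat_exp_0 mat_def if_distrib [where f = "\<lambda>x. x * _"] cong: if_cong)
  moreover have "q 0 = (mat_exp (t *\<^sub>R M) *v z 0) $ i"
    by (simp add: q_def matrix_vector_mult_def)
  ultimately show "((\<lambda>s. (?E s *v h s) \<bullet> b) has_integral ((z t - mat_exp (t *\<^sub>R M) *v z 0) \<bullet> b)) {0..t}"
    by (simp add: b inner_axis)
qed

section \<open>The derivative of the output\<close>

lemma outer_vector_mult: "outer a b *v v = (b \<bullet> v) *\<^sub>R a"
  by (simp add: vec_eq_iff outer_def matrix_vector_mult_def inner_vec_def sum_distrib_left mult_ac)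

lemma time_interval_atLeastAtMost:
  "t \<in> time_interval T \<Longrightarrow> {0..t} \<subseteq> time_interval T"
  by (auto simp: time_interval_def) (meson ereal_less_eq(3) le_less_trans)

text \<open>
  The difference \<open>z\<close> of the plant state and the filter state is driven by the disturbance alone and
  starts from \<open>x 0\<close>, so that \<open>variation_of_constants\<close> makes its share of \<open>dy/dt\<close> equal to \<open>phi_bar\<close>;
  the filter state contributes \<open>w\<close>.
\<close>

lemma output_derivative:
  fixes A Abar :: "real ^ 'n ^ 'n" and B D L :: "real ^ 'n" and x :: "real \<Rightarrow> real ^ 'n"
  assumes f: "piecewise_cont f"
    and Abar: "Abar = A + k *\<^sub>R outer B L"
    and u: "\<And>t. u t = k * (L \<bullet> x t) + v t"
    and v: "continuous_on (time_interval T) v"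
    and plant: "plant_trajectory A B D f T x u"
    and lti: "lti_output ([:0, 1:] * R_poly A B L) (Q_poly A - [:k:] * R_poly A B L) T v w"
  shows "continuous_on (time_interval T) w"
    and "\<And>t. t \<in> time_interval T \<Longrightarrow>
      L \<bullet> (A *v x t + u t *\<^sub>R B + f t *\<^sub>R D) = w t + phi_bar Abar D L (x 0) f t"
proof -
  obtain X where X0: "X 0 = 0"
    and dX: "\<And>t. t \<in> time_interval T \<Longrightarrow>
      (X has_vector_derivative (Abar *v X t + v t *\<^sub>R B)) (at t within time_interval T)"
    and w: "\<And>t. t \<in> time_interval T \<Longrightarrow> w t = L \<bullet> (Abar *v X t + v t *\<^sub>R B)"
    using lti_output_realization [OF Abar lti] by blast
  have Xc: "continuous_on (time_interval T) X"
    using dX by (auto simp: continuous_on_eq_continuous_within intro: has_vector_derivative_continuous)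
  have xc: "continuous_on (time_interval T) x" using plant by (simp add: plant_trajectory_def)
  have "continuous_on (time_interval T) (\<lambda>t. L \<bullet> (Abar *v X t + v t *\<^sub>R B))"
    by (intro continuous_intros v linear_continuous_on_compose [OF Xc matrix_vector_mul_linear])
  then show "continuous_on (time_interval T) w"
    by (simp add: w cong: continuous_on_cong)
  have closed_loop: "A *v x s + u s *\<^sub>R B + f s *\<^sub>R D = Abar *v x s + v s *\<^sub>R B + f s *\<^sub>R D" for s
    by (simp add: Abar u matrix_vector_mult_add_rdistrib scaleR_matrix_vector_assoc [symmetric]
        outer_vector_mult scaleR_add_left)
  define z where "z t = x t - X t" for t
  fix t assume t: "t \<in> time_interval T"
  then have t0: "0 \<le> t" by (simp add: time_interval_def)
  note sub = time_interval_atLeastAtMost [OF t]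
  have zc: "continuous_on {0..t} z"
    unfolding z_def by (intro continuous_intros continuous_on_subset [OF xc sub] continuous_on_subset [OF Xc sub])
  have z_int: "((\<lambda>s. Abar *v z s + f s *\<^sub>R D) has_integral (z s - z 0)) {0..s}" if s: "s \<in> {0..t}" for s
  proof -
    have sT: "s \<in> time_interval T" using s sub by auto
    have "((\<lambda>s. Abar *v X s + v s *\<^sub>R B) has_integral (X s - X 0)) {0..s}"
      using s sub by (intro fundamental_theorem_of_calculus has_vector_derivative_within_subset [OF dX]) auto
    moreover have "((\<lambda>s. Abar *v x s + v s *\<^sub>R B + f s *\<^sub>R D) has_integral (x s - x 0)) {0..s}"
      using plant sT unfolding plant_trajectory_def closed_loop by blast
    ultimately have "((\<lambda>s. (Abar *v x s + v s *\<^sub>R B + f s *\<^sub>R D) - (Abar *v X s + v s *\<^sub>R B))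
        has_integral ((x s - x 0) - (X s - X 0))) {0..s}"
      using has_integral_diff by blast
    then show ?thesis by (simp add: z_def matrix_vector_mult_diff_distrib algebra_simps)
  qed
  obtain S where S: "finite S" "continuous_on ({0..t} - S) f"
  proof (cases "t = 0")
    case True
    then show ?thesis using that [of "{0}"] by simp
  next
    case False
    then show ?thesis using that f t0 unfolding piecewise_cont_def by (metis less_eq_real_def)
  qed
  have "((\<lambda>s. mat_exp ((t - s) *\<^sub>R Abar) *v (f s *\<^sub>R D)) has_integral
      (z t - mat_exp (t *\<^sub>R Abar) *v z 0)) {0..t}"
    by (rule variation_of_constants [OF t0 S(1) _ zc z_int]) (intro continuous_intros S)
  then have "integral {0..t} (\<lambda>s. mat_exp ((t - s) *\<^sub>R Abar) *v (f s *\<^sub>R D))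
      = z t - mat_exp (t *\<^sub>R Abar) *v x 0"
    by (simp add: integral_unique z_def X0)
  then have "phi_bar Abar D L (x 0) f t = L \<bullet> (Abar *v z t) + (L \<bullet> D) * f t"
    unfolding phi_bar_def by (simp add: matrix_vector_mult_diff_distrib inner_diff_right)
  then show "L \<bullet> (A *v x t + u t *\<^sub>R B + f t *\<^sub>R D) = w t + phi_bar Abar D L (x 0) f t"
    unfolding closed_loop w [OF t] z_def
    by (simp add: matrix_vector_mult_diff_distrib inner_diff_right inner_add_right)
qed

section \<open>Chain rules for indefinite integrals of bounded functions\<close>

text \<open>
  A chain rule for \<open>u = u a + \<integral> g\<close> in which \<open>g\<close> may be discontinuous everywhere, so that \<open>u\<close> need not
  be differentiable at any prescribed point.  The difference \<open>G (u t) - \<integral> G' (u) g\<close> is nevertheless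
  differentiable everywhere with derivative \<open>0\<close>: freezing \<open>G' (u)\<close> at the point \<open>t\<close> changes the
  integrand by \<open>(G' (u s) - G' (u t)) g s\<close>, which tends to \<open>0\<close> as \<open>s \<rightarrow> t\<close> since \<open>g\<close> is bounded, and
  for the frozen coefficient the remainder is of first order in \<open>u s - u t\<close>, hence \<open>o (s - t)\<close>.
\<close>

lemma integral_chain_rule:
  fixes u g G G' :: "real \<Rightarrow> real"
  assumes ab: "a \<le> b" and u: "continuous_on {a..b} u"
    and g: "\<And>t. t \<in> {a..b} \<Longrightarrow> (g has_integral (u t - u a)) {a..t}"
    and C: "\<And>t. t \<in> {a..b} \<Longrightarrow> \<bar>g t\<bar> \<le> C"
    and G: "\<And>v. (G has_real_derivative G' v) (at v)" and G': "continuous_on UNIV G'"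
  shows "((\<lambda>s. G' (u s) * g s) has_integral (G (u b) - G (u a))) {a..b}"
proof -
  have g_int: "g integrable_on {a..b}" using g [of b] ab by auto
  have g_abs: "g absolutely_integrable_on {a..b}"
    by (rule absolutely_integrable_integrable_bound [where g = "\<lambda>_. C"]) (use C g_int in auto)
  have C0: "0 \<le> C" using C [of a] ab by (auto intro: order_trans [OF abs_ge_zero])
  have contG': "continuous_on {a..b} (\<lambda>s. G' (u s))"
    using continuous_on_compose2 [OF G' u] by simp
  have prod_int: "(\<lambda>s. (G' (u s) - c) * g s) integrable_on {a..b}" for c
  proof -
    have "continuous_on {a..b} (\<lambda>s. G' (u s) - c)" by (intro continuous_intros contG')
    then have "(\<lambda>s. (G' (u s) - c) * g s) absolutely_integrable_on {a..b}"
      by (intro absolutely_integrable_bounded_measurable_product_real g_abs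
          continuous_imp_measurable_on_sets_lebesgue compact_imp_bounded compact_continuous_image) auto
    then show ?thesis using absolutely_integrable_on_def by blast
  qed
  define h where "h s = G' (u s) * g s" for s
  have h_int: "h integrable_on {a..b}" using prod_int [of 0] unfolding h_def by simp
  have lip: "\<bar>u s - u t\<bar> \<le> C * \<bar>s - t\<bar>" if "s \<in> {a..b}" "t \<in> {a..b}" for s t
  proof -
    have *: "\<bar>u s - u t\<bar> \<le> C * \<bar>s - t\<bar>" if "t \<le> s" "s \<in> {a..b}" "t \<in> {a..b}" for s t
    proof -
      have i: "g integrable_on {t..s}" by (rule integrable_subinterval_real [OF g_int]) (use that in auto)
      have "integral {a..t} g + integral {t..s} g = integral {a..s} g"
        by (rule Henstock_Kurzweil_Integration.integral_combine) (use that in \<open>auto intro: integrable_subinterval_real [OF g_int]\<close>)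
      moreover have "integral {a..t} g = u t - u a" "integral {a..s} g = u s - u a"
        using g that by (auto intro: integral_unique)
      ultimately have "(g has_integral (u s - u t)) {t..s}"
        using i by (metis (no_types, opaque_lifting) add_diff_cancel_left' diff_diff_eq2 diff_add_cancel has_integral_integral)
      then show ?thesis
        using has_integral_bound [of C g "u s - u t" t s] C0 C that by (auto simp: content_real)
    qed
    show ?thesis using *[of t s] *[of s t] that by (cases "t \<le> s") (auto simp: abs_minus_commute)
  qed
  have deriv: "((\<lambda>t. G (u t) - integral {a..t} h) has_field_derivative 0) (at t within {a..b})"
    if t: "t \<in> {a..b}" for t
  proof -
    define k where "k s = (G' (u s) - G' (u t)) * g s" for s
    have "((\<lambda>s. C * (G' (u s) - G' (u t))) \<longlongrightarrow> C * (G' (u t) - G' (u t))) (at t within {a..b})"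
      using contG' t by (intro tendsto_intros) (auto simp: continuous_on_def)
    from tendsto_norm [OF this]
    have lim0: "((\<lambda>s. norm (C * (G' (u s) - G' (u t)))) \<longlongrightarrow> 0) (at t within {a..b})"
      by simp
    have "(k \<longlongrightarrow> 0) (at t within {a..b})"
    proof (rule Lim_null_comparison [OF _ lim0])
      show "\<forall>\<^sub>F s in at t within {a..b}. norm (k s) \<le> norm (C * (G' (u s) - G' (u t)))"
        unfolding eventually_at_filter k_def norm_mult using C C0
        by (auto intro!: always_eventually simp: mult.commute [of C] mult_left_mono)
    qed
    then have "continuous (at t within {a..b} - {}) k"
      by (simp add: continuous_within k_def)
    moreover have "k integrable_on {a..b}" unfolding k_def by (rule prod_int)
    ultimately have "((\<lambda>s. integral {a..s} k) has_vector_derivative k t) (at t within {a..b} - {})"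
      using t by (intro integral_has_vector_derivative_continuous_at) auto
    then have 1: "((\<lambda>s. integral {a..s} k) has_field_derivative 0) (at t within {a..b})"
      by (simp add: k_def has_real_derivative_iff_has_vector_derivative)
    have int_k: "integral {a..s} k = integral {a..s} h - G' (u t) * (u s - u a)" if "s \<in> {a..b}" for s
    proof -
      have "(h has_integral integral {a..s} h) {a..s}"
        by (rule integrable_integral, rule integrable_subinterval_real [OF h_int]) (use that in auto)
      from has_integral_diff [OF this has_integral_mult_right [OF g [OF that], of "G' (u t)"]]
      show ?thesis by (auto simp: k_def [abs_def] h_def left_diff_distrib intro!: integral_unique)
    qed
    have 2: "((\<lambda>s. G (u s) - G' (u t) * u s) has_field_derivative 0) (at t within {a..b})"
      unfolding has_field_derivative_def has_derivative_within_alt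
    proof (intro conjI allI impI)
      fix e :: real assume e: "e > 0"
      have "((\<lambda>v. G v - G' (u t) * v) has_field_derivative 0) (at (u t))"
        by (auto intro!: derivative_eq_intros G)
      then have "\<forall>e>0. \<exists>d>0. \<forall>v. \<bar>v - u t\<bar> < d \<longrightarrow>
          \<bar>G v - G' (u t) * v - (G (u t) - G' (u t) * u t)\<bar> \<le> e * \<bar>v - u t\<bar>"
        by (simp add: has_field_derivative_def has_derivative_within_alt)
      moreover have "e / (C + 1) > 0" using e C0 by simp
      ultimately obtain d where d: "d > 0"
          "\<And>v. \<bar>v - u t\<bar> < d \<Longrightarrow> \<bar>G v - G' (u t) * v - (G (u t) - G' (u t) * u t)\<bar> \<le> e / (C + 1) * \<bar>v - u t\<bar>"
        by metis
      show "\<exists>d>0. \<forall>s\<in>{a..b}. norm (s - t) < d \<longrightarrow>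
          norm (G (u s) - G' (u t) * u s - (G (u t) - G' (u t) * u t) - 0 * (s - t)) \<le> e * norm (s - t)"
      proof (intro exI [of _ "d / (C + 1)"] conjI ballI impI)
        show "d / (C + 1) > 0" using d C0 by simp
        fix s assume s: "s \<in> {a..b}" "norm (s - t) < d / (C + 1)"
        have l: "\<bar>u s - u t\<bar> \<le> (C + 1) * \<bar>s - t\<bar>"
          using lip [OF s(1) t] by (simp add: distrib_right)
        also have "\<dots> < d" using s C0 by (simp add: field_simps)
        finally have "\<bar>G (u s) - G' (u t) * u s - (G (u t) - G' (u t) * u t)\<bar> \<le> e / (C + 1) * \<bar>u s - u t\<bar>"
          by (rule d)
        also have "\<dots> \<le> e / (C + 1) * ((C + 1) * \<bar>s - t\<bar>)"
          using l e C0 by (intro mult_left_mono) auto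
        also have "\<dots> = e * \<bar>s - t\<bar>" using C0 by simp
        finally show "norm (G (u s) - G' (u t) * u s - (G (u t) - G' (u t) * u t) - 0 * (s - t)) \<le> e * norm (s - t)"
          by simp
      qed
    qed (rule bounded_linear_mult_right)
    have "((\<lambda>s. (G (u s) - G' (u t) * u s) - integral {a..s} k + G' (u t) * u a) has_field_derivative 0 - 0 + 0) (at t within {a..b})"
      by (intro derivative_intros 1 2)
    then have "((\<lambda>s. (G (u s) - G' (u t) * u s) - integral {a..s} k + G' (u t) * u a) has_field_derivative 0) (at t within {a..b})"
      by simp
    then show ?thesis
      by (rule has_field_derivative_transform_within [where d = 1]) (use t in \<open>auto simp: int_k algebra_simps\<close>)
  qed
  have "\<exists>c. \<forall>t\<in>{a..b}. G (u t) - integral {a..t} h = c"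
    by (rule has_field_derivative_zero_constant) (auto intro: deriv)
  then obtain c where "\<forall>t\<in>{a..b}. G (u t) - integral {a..t} h = c" by blast
  from bspec [OF this, of a] bspec [OF this, of b] have "G (u b) - integral {a..b} h = G (u a) - integral {a..a} h" using ab by auto
  then have "integral {a..b} h = G (u b) - G (u a)" by simp
  then have "(h has_integral (G (u b) - G (u a))) {a..b}"
    using integrable_integral [OF h_int] by simp
  then show ?thesis by (simp add: h_def [abs_def])
qed

text \<open>
  The law for \<open>u\<^sub>2\<close> uses the sign function with value \<open>\<sigma> = \<plusminus>1\<close> at \<open>0\<close>, so the zeros of \<open>u\<close> contribute to
  the integral below although \<open>\<bar>u\<bar>\<close> has no derivative there.  The identity still holds with either
  choice of \<open>\<sigma>\<close>; this forces \<open>g = 0\<close> almost everywhere on the zero set.  To see it without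
  discussing that set, \<open>\<bar>v\<bar>\<close> is approximated by smooth functions whose derivatives converge to the sign
  function at every point, with limit \<open>\<sigma>\<close> at \<open>0\<close>, and dominated convergence is applied.
\<close>

lemma has_integral_abs_sign:
  fixes u g :: "real \<Rightarrow> real"
  assumes ab: "a \<le> b" and u: "continuous_on {a..b} u"
    and g: "\<And>t. t \<in> {a..b} \<Longrightarrow> (g has_integral (u t - u a)) {a..t}"
    and C: "\<And>t. t \<in> {a..b} \<Longrightarrow> \<bar>g t\<bar> \<le> C" and sigma: "\<bar>\<sigma>\<bar> = 1"
  shows "((\<lambda>s. sign_at0 \<sigma> (u s) * g s) has_integral (\<bar>u b\<bar> - \<bar>u a\<bar>)) {a..b}"
proof -
  \<comment> \<open>At \<open>v = 0\<close> the derivative of \<open>sqrt ((v + \<sigma> \<rho>)\<^sup>2 + \<rho>\<^sup>3)\<close> is \<open>\<sigma> / sqrt (1 + \<rho>)\<close>: the shift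
    \<open>\<sigma> \<rho>\<close> selects the side, and the smoothing scale \<open>\<rho> powr (3 / 2)\<close> vanishes faster than the shift.\<close>
  define \<rho> where "\<rho> n = inverse (real (Suc n))" for n
  have \<rho>: "\<rho> n > 0" for n by (simp add: \<rho>_def)
  have \<rho>0: "\<rho> \<longlonglongrightarrow> 0" unfolding \<rho>_def by (rule LIMSEQ_inverse_real_of_nat)
  define N where "N n v = sqrt ((v + \<sigma> * \<rho> n)\<^sup>2 + \<rho> n ^ 3)" for n v
  define N' where "N' n v = (v + \<sigma> * \<rho> n) / N n v" for n v
  have pos: "(v + \<sigma> * \<rho> n)\<^sup>2 + \<rho> n ^ 3 > 0" for n v
    using \<rho> [of n] by (simp add: add_nonneg_pos)
  have Npos: "N n v > 0" for n v using pos by (simp add: N_def)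
  have dN: "(N n has_real_derivative N' n v) (at v)" for n v
  proof -
    have "((\<lambda>v. (v + \<sigma> * \<rho> n)\<^sup>2 + \<rho> n ^ 3) has_real_derivative 2 * (v + \<sigma> * \<rho> n)) (at v)"
      by (auto intro!: derivative_eq_intros)
    from DERIV_chain2 [OF DERIV_real_sqrt [OF pos] this]
    have "(N n has_real_derivative inverse (N n v) / 2 * (2 * (v + \<sigma> * \<rho> n))) (at v)"
      unfolding N_def .
    moreover have "inverse r / 2 * (2 * q) = q / r" for q r :: real
      by (cases "r = 0") (simp_all add: field_simps)
    then have "inverse (N n v) / 2 * (2 * (v + \<sigma> * \<rho> n)) = N' n v"
      unfolding N'_def .
    ultimately show ?thesis by (simp only:)
  qed
  have cN': "continuous_on UNIV (N' n)" for n
  proof -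
    have "continuous_on UNIV (N n)" unfolding N_def by (intro continuous_intros)
    moreover have "N n v \<noteq> 0" for v using Npos [of n v] by simp
    ultimately have "continuous_on UNIV (\<lambda>v. (v + \<sigma> * \<rho> n) / N n v)"
      by (intro continuous_on_divide continuous_intros) auto
    then show ?thesis unfolding N'_def .
  qed
  have N'1: "\<bar>N' n v\<bar> \<le> 1" for n v
  proof -
    have "\<bar>v + \<sigma> * \<rho> n\<bar> \<le> N n v"
      unfolding N_def using \<rho> [of n] by (intro real_le_rsqrt) auto
    then show ?thesis using Npos [of n v] by (simp add: N'_def)
  qed
  have Nlim: "(\<lambda>n. N n v) \<longlonglongrightarrow> \<bar>v\<bar>" for v
  proof -
    have "(\<lambda>n. N n v) \<longlonglongrightarrow> sqrt ((v + \<sigma> * 0)\<^sup>2 + 0 ^ 3)"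
      unfolding N_def by (intro tendsto_intros \<rho>0)
    then show ?thesis by simp
  qed
  have sigma2: "\<sigma>\<^sup>2 = 1" using sigma by (metis one_power2 power2_abs)
  have N'lim: "(\<lambda>n. N' n v) \<longlonglongrightarrow> sign_at0 \<sigma> v" for v
  proof (cases "v = 0")
    case True
    have "N' n 0 = \<sigma> / sqrt (1 + \<rho> n)" for n
    proof -
      have "(0 + \<sigma> * \<rho> n)\<^sup>2 + \<rho> n ^ 3 = (\<rho> n)\<^sup>2 * (1 + \<rho> n)"
        using sigma2 by (simp add: power_mult_distrib power2_eq_square power3_eq_cube distrib_left)
      then show ?thesis using \<rho> [of n] by (simp add: N'_def N_def real_sqrt_mult)
    qed
    moreover have "(\<lambda>n. \<sigma> / sqrt (1 + \<rho> n)) \<longlonglongrightarrow> \<sigma> / sqrt (1 + 0)"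
      by (intro tendsto_intros \<rho>0) auto
    ultimately show ?thesis using True by (simp add: sign_at0_def)
  next
    case False
    have "(\<lambda>n. N' n v) \<longlonglongrightarrow> (v + \<sigma> * 0) / \<bar>v\<bar>"
      unfolding N'_def using False by (intro tendsto_intros \<rho>0 Nlim) auto
    moreover have "(v + \<sigma> * 0) / \<bar>v\<bar> = sign_at0 \<sigma> v"
      using False by (simp add: sign_at0_def sgn_real_def abs_if)
    ultimately show ?thesis by simp
  qed
  have step: "((\<lambda>s. N' n (u s) * g s) has_integral (N n (u b) - N n (u a))) {a..b}" for n
    by (rule integral_chain_rule [OF ab u g C dN cN'])
  have bound: "norm (N' n (u s) * g s) \<le> C" if "s \<in> {a..b}" for n s
    using mult_mono [OF N'1 [of n "u s"] C [OF that]] by (simp add: abs_mult)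
  have lim: "(\<lambda>n. N' n (u s) * g s) \<longlonglongrightarrow> sign_at0 \<sigma> (u s) * g s" for s
    by (intro tendsto_intros N'lim)
  note dc = dominated_convergence [where f = "\<lambda>n s. N' n (u s) * g s" and S = "{a..b}",
      OF has_integral_integrable [OF step] integrable_const_ivl bound lim]
  have "(\<lambda>n. N n (u b) - N n (u a)) \<longlonglongrightarrow> \<bar>u b\<bar> - \<bar>u a\<bar>"
    by (intro tendsto_intros Nlim)
  then have "(\<lambda>n. integral {a..b} (\<lambda>s. N' n (u s) * g s)) \<longlonglongrightarrow> \<bar>u b\<bar> - \<bar>u a\<bar>"
    by (simp add: integral_unique [OF step])
  with dc(2) have "integral {a..b} (\<lambda>s. sign_at0 \<sigma> (u s) * g s) = \<bar>u b\<bar> - \<bar>u a\<bar>"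
    by (rule LIMSEQ_unique)
  with integrable_integral [OF dc(1)] show ?thesis by simp
qed

section \<open>The integral equation for the controlled quantity\<close>

lemma continuous_on_Icc_bounded:
  fixes h :: "real \<Rightarrow> real"
  assumes "continuous_on {a..b} h"
  obtains C where "0 \<le> C" "\<And>t. t \<in> {a..b} \<Longrightarrow> \<bar>h t\<bar> \<le> C"
proof -
  have "bounded (h ` {a..b})"
    using assms by (intro compact_imp_bounded compact_continuous_image) auto
  then obtain C where "C > 0" "\<forall>x\<in>h ` {a..b}. norm x \<le> C" by (auto simp: bounded_pos)
  then show ?thesis by (intro that [of C]) auto
qed

text \<open>
  The law for \<open>u\<^sub>2\<close> is the one for which the derivative of \<open>p\<^sub>3 (\<bar>u\<^sub>2\<bar> + \<delta>)\<^sup>2\<close> is minus the bracket.  The term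
  \<open>2 q y w\<close> of the bracket then cancels the known part of the derivative of \<open>q y\<^sup>2\<close>, leaving the unknown
  part \<open>2 q y \<phi>\<close>.  The bound on \<open>\<epsilon>\<close> keeps the right-hand side of the law bounded, as the two chain
  rules require.
\<close>

lemma energy_balance:
  fixes y w u \<phi> \<epsilon> :: "real \<Rightarrow> real"
  assumes y: "continuous_on {0..b} y" and w: "continuous_on {0..b} w" and u: "continuous_on {0..b} u"
    and y_int: "\<And>t. t \<in> {0..b} \<Longrightarrow> ((\<lambda>s. w s + \<phi> s) has_integral (y t - y 0)) {0..t}"
    and phi: "\<And>t. t \<in> {0..b} \<Longrightarrow> \<bar>\<phi> t\<bar> \<le> P"
    and u_int: "\<And>t. t \<in> {0..b} \<Longrightarrow>
      ((\<lambda>s. u2_rhs \<sigma> p3 \<delta> \<alpha> q \<mu> (u s) (\<epsilon> s) (y s) (w s)) has_integral (u t - u 0)) {0..t}"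
    and eps: "\<And>t. t \<in> {0..b} \<Longrightarrow> \<bar>\<epsilon> t\<bar> \<le> K"
    and p3: "p3 > 0" and delta: "\<delta> > 0" and sigma: "\<bar>\<sigma>\<bar> = 1"
    and t: "t \<in> {0..b}"
  shows "((\<lambda>s. 2 * q * y s * \<phi> s - \<alpha> * \<epsilon> s - \<mu> * q\<^sup>2 * sgn (\<epsilon> s) * (y s)\<^sup>2) has_integral
    (q * (y t)\<^sup>2 + p3 * (\<bar>u t\<bar> + \<delta>)\<^sup>2) - (q * (y 0)\<^sup>2 + p3 * (\<bar>u 0\<bar> + \<delta>)\<^sup>2)) {0..t}"
proof -
  define br where "br s = \<alpha> * \<epsilon> s + 2 * q * y s * w s + \<mu> * q\<^sup>2 * sgn (\<epsilon> s) * (y s)\<^sup>2" for s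
  define g where "g s = u2_rhs \<sigma> p3 \<delta> \<alpha> q \<mu> (u s) (\<epsilon> s) (y s) (w s)" for s
  have sign1: "\<bar>sign_at0 \<sigma> z\<bar> = 1" for z using sigma by (simp add: sign_at0_def abs_sgn_eq)
  have g_eq: "g s = - (1 / (2 * p3 * (\<bar>u s\<bar> + \<delta>))) * sign_at0 \<sigma> (u s) * br s" for s
    by (simp add: g_def u2_rhs_def br_def)
  obtain Y where Y: "0 \<le> Y" "\<And>t. t \<in> {0..b} \<Longrightarrow> \<bar>y t\<bar> \<le> Y"
    using continuous_on_Icc_bounded [OF y] by blast
  obtain W where W: "0 \<le> W" "\<And>t. t \<in> {0..b} \<Longrightarrow> \<bar>w t\<bar> \<le> W"
    using continuous_on_Icc_bounded [OF w] by blast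
  define C where "C = \<bar>\<alpha>\<bar> * K + 2 * \<bar>q\<bar> * Y * W + \<bar>\<mu>\<bar> * q\<^sup>2 * 1 * Y\<^sup>2"
  have br_le: "\<bar>br s\<bar> \<le> C" if s: "s \<in> {0..b}" for s
  proof -
    have "\<bar>br s\<bar> \<le> \<bar>\<alpha> * \<epsilon> s\<bar> + \<bar>2 * q * y s * w s\<bar> + \<bar>\<mu> * q\<^sup>2 * sgn (\<epsilon> s) * (y s)\<^sup>2\<bar>"
      unfolding br_def by linarith
    also have "\<dots> = \<bar>\<alpha>\<bar> * \<bar>\<epsilon> s\<bar> + 2 * \<bar>q\<bar> * \<bar>y s\<bar> * \<bar>w s\<bar> + \<bar>\<mu>\<bar> * q\<^sup>2 * \<bar>sgn (\<epsilon> s)\<bar> * \<bar>y s\<bar>\<^sup>2"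
      by (simp add: abs_mult)
    also have "\<dots> \<le> C"
      unfolding C_def using Y W eps s
      by (intro add_mono mult_mono power_mono order_refl) (auto simp: abs_sgn_eq)
    finally show ?thesis .
  qed
  have g_le: "\<bar>g s\<bar> \<le> C / (2 * p3 * \<delta>)" if s: "s \<in> {0..b}" for s
  proof -
    have "\<bar>g s\<bar> = \<bar>br s\<bar> / (2 * p3 * (\<bar>u s\<bar> + \<delta>))"
      using p3 delta by (simp add: g_eq abs_mult sign1)
    also have "\<dots> \<le> C / (2 * p3 * \<delta>)"
      using p3 delta br_le [OF s] by (intro frac_le mult_left_mono) auto
    finally show ?thesis .
  qed
  have sub: "{0..t} \<subseteq> {0..b}" and t0: "0 \<le> t" using t by auto
  have abs_u: "((\<lambda>s. sign_at0 \<sigma> (u s) * g s) has_integral (\<bar>u r\<bar> - \<bar>u 0\<bar>)) {0..r}" if "r \<in> {0..t}" for r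
    by (rule has_integral_abs_sign [where C = "C / (2 * p3 * \<delta>)", OF _ continuous_on_subset [OF u] _ _ sigma])
      (use that t g_le u_int in \<open>auto simp: g_def\<close>)
  have "((\<lambda>s. 2 * p3 * (\<bar>u s\<bar> + \<delta>) * (sign_at0 \<sigma> (u s) * g s)) has_integral
      (p3 * (\<bar>u t\<bar> + \<delta>)\<^sup>2 - p3 * (\<bar>u 0\<bar> + \<delta>)\<^sup>2)) {0..t}"
  proof (rule integral_chain_rule [where u = "\<lambda>s. \<bar>u s\<bar>" and G = "\<lambda>v. p3 * (v + \<delta>)\<^sup>2"
        and G' = "\<lambda>v. 2 * p3 * (v + \<delta>)" and C = "C / (2 * p3 * \<delta>)", OF t0 _ abs_u])
    show "continuous_on {0..t} (\<lambda>s. \<bar>u s\<bar>)"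
      by (intro continuous_intros continuous_on_subset [OF u sub])
    show "\<bar>sign_at0 \<sigma> (u s) * g s\<bar> \<le> C / (2 * p3 * \<delta>)" if "s \<in> {0..t}" for s
      using g_le sub that by (auto simp: abs_mult sign1)
    show "((\<lambda>v. p3 * (v + \<delta>)\<^sup>2) has_real_derivative 2 * p3 * (v + \<delta>)) (at v)" for v
      by (auto intro!: derivative_eq_intros)
  qed (auto intro!: continuous_intros)
  moreover have "2 * p3 * (\<bar>u s\<bar> + \<delta>) * (sign_at0 \<sigma> (u s) * g s) = - br s" for s
  proof -
    have "sign_at0 \<sigma> (u s) * sign_at0 \<sigma> (u s) = 1"
      using sign1 [of "u s"] by (metis abs_mult_self_eq mult_1)
    moreover have "2 * p3 * (\<bar>u s\<bar> + \<delta>) \<noteq> 0" using p3 delta by (simp add: add_nonneg_pos less_imp_neq [symmetric])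
    moreover have "m * (\<eta> * (- (1 / m) * \<eta> * c)) = - c" if "\<eta> * \<eta> = 1" "m \<noteq> 0" for m \<eta> c :: real
    proof -
      have "m * (\<eta> * (- (1 / m) * \<eta> * c)) = - (m * (1 / m)) * (\<eta> * \<eta>) * c"
        by (simp only: mult_ac minus_mult_left [symmetric] minus_mult_right [symmetric])
      then show ?thesis using that by simp
    qed
    ultimately show ?thesis unfolding g_eq by blast
  qed
  ultimately have U: "((\<lambda>s. - br s) has_integral (p3 * (\<bar>u t\<bar> + \<delta>)\<^sup>2 - p3 * (\<bar>u 0\<bar> + \<delta>)\<^sup>2)) {0..t}"
    by simp
  have "((\<lambda>s. 2 * q * y s * (w s + \<phi> s)) has_integral (q * (y t)\<^sup>2 - q * (y 0)\<^sup>2)) {0..t}"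
  proof (rule integral_chain_rule [where u = y and G = "\<lambda>v. q * v\<^sup>2" and G' = "\<lambda>v. 2 * q * v"
        and C = "W + P", OF t0 continuous_on_subset [OF y sub]])
    show "\<bar>w s + \<phi> s\<bar> \<le> W + P" if "s \<in> {0..t}" for s
      using abs_triangle_ineq [of "w s" "\<phi> s"] W(2) [of s] phi [of s] sub that by force
    show "((\<lambda>v. q * v\<^sup>2) has_real_derivative 2 * q * v) (at v)" for v
      by (auto intro!: derivative_eq_intros)
  qed (use sub y_int in \<open>auto intro!: continuous_intros\<close>)
  from has_integral_add [OF this U] show ?thesis
    by (simp add: br_def algebra_simps)
qed

section \<open>Barriers\<close>

lemma first_zero:
  fixes m :: "real \<Rightarrow> real"
  assumes m: "continuous_on {0..b} m" and "0 \<le> b" "m 0 > 0" "m b \<le> 0"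
  obtains t where "0 < t" "t \<le> b" "m t = 0" "\<And>s. 0 \<le> s \<Longrightarrow> s < t \<Longrightarrow> m s > 0"
proof -
  let ?Z = "{0..b} \<inter> m -` {..0}"
  have "closed ?Z" by (intro continuous_closed_preimage m) auto
  then have "compact ?Z" by (metis compact_Icc compact_Int_closed inf.left_idem)
  moreover have "b \<in> ?Z" using assms by simp
  ultimately obtain t where t: "t \<in> ?Z" "\<And>s. s \<in> ?Z \<Longrightarrow> t \<le> s"
    using continuous_attains_inf [of ?Z "\<lambda>t. t"] by (metis continuous_on_id empty_iff)
  have pos: "m s > 0" if "0 \<le> s" "s < t" for s
    using t(2) [of s] t(1) that by force
  have "\<exists>s\<ge>0. s \<le> t \<and> m s = 0"
    using t(1) assms by (intro IVT2') (auto intro: continuous_on_subset [OF m])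
  with pos have "m t = 0" by (metis less_eq_real_def less_irrefl)
  then show ?thesis using that [of t] t(1) pos assms by (auto simp: less_eq_real_def)
qed

text \<open>
  Just before a first contact \<open>\<xi>\<close> lies above \<open>a'\<close>, where it decreases at rate at least \<open>c\<close>, whereas the
  barrier \<open>a\<close> descends at rate at most \<open>\<gamma> < c\<close>.  Going backwards from the contact, \<open>\<xi>\<close> would thus have
  been above \<open>a\<close>.
\<close>

lemma no_contact:
  fixes \<xi> a a' r :: "real \<Rightarrow> real"
  assumes t: "0 < t" and cont: "continuous_on {0..t} \<xi>" "continuous_on {0..t} a'"
    and below: "\<And>s. 0 \<le> s \<Longrightarrow> s < t \<Longrightarrow> \<xi> s < a s" and inner: "a' t < \<xi> t"
    and r: "\<And>s. 0 \<le> s \<Longrightarrow> s \<le> t \<Longrightarrow> (r has_integral (\<xi> t - \<xi> s)) {s..t}"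
    and drift: "\<And>s. 0 \<le> s \<Longrightarrow> s \<le> t \<Longrightarrow> a' s < \<xi> s \<Longrightarrow> r s \<le> - c"
    and lip: "\<And>s. 0 \<le> s \<Longrightarrow> s \<le> t \<Longrightarrow> a s - a t \<le> \<gamma> * (t - s)" and c: "\<gamma> < c"
  shows "\<xi> t \<noteq> a t"
proof
  assume eq: "\<xi> t = a t"
  have "continuous_on {0..t} (\<lambda>s. \<xi> s - a' s)" by (intro continuous_intros cont)
  then have "continuous (at t within {0..t}) (\<lambda>s. \<xi> s - a' s)"
    using t by (simp add: continuous_on_eq_continuous_within)
  then obtain d where d: "d > 0"
    "\<And>s. s \<in> {0..t} \<Longrightarrow> dist s t < d \<Longrightarrow> dist (\<xi> s - a' s) (\<xi> t - a' t) < \<xi> t - a' t"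
    using inner unfolding continuous_within_eps_delta by (metis diff_gt_0_iff_gt)
  define s where "s = max 0 (t - d / 2)"
  have s: "0 \<le> s" "s < t" using t d(1) by (auto simp: s_def)
  have near: "a' v < \<xi> v" if "v \<in> {s..t}" for v
  proof -
    have "dist v t < d" using that d(1) by (auto simp: s_def dist_real_def)
    with d(2) [of v] that s show ?thesis by (auto simp: dist_real_def)
  qed
  have "\<xi> t - \<xi> s \<le> - c * (t - s)"
  proof (rule has_integral_le [OF r])
    show "((\<lambda>_. - c) has_integral - c * (t - s)) {s..t}"
      using has_integral_const_real [of "- c" s t] s by (simp add: mult.commute)
  qed (use s near drift in auto)
  moreover have "a s - a t \<le> \<gamma> * (t - s)" using lip s by simp
  moreover have "\<gamma> * (t - s) < c * (t - s)" using c s by (intro mult_strict_right_mono) auto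
  ultimately have "a s < \<xi> s" using eq by linarith
  with below [OF s] show False by simp
qed

section \<open>The closed loop\<close>

theorem mainTheorem2:
  fixes A :: "real ^ 'n ^ 'n" and B D L :: "real ^ 'n"
    and f l_y l_u gl gu :: "real \<Rightarrow> real" and fbar :: real
    and p0 p1 p2 p3 r \<delta> \<mu> \<beta> c k \<gamma> :: real
    and \<Phi> \<Phi>\<^sub>\<epsilon> \<Phi>\<^sub>t :: "real \<Rightarrow> real \<Rightarrow> real"
    and Abar :: "real ^ 'n ^ 'n" and p1bar phihat :: real
    and H :: "real ^ 'n ^ 'n" and \<alpha> \<tau>\<^sub>1 \<tau>\<^sub>2 \<tau>\<^sub>3 \<tau>\<^sub>4 \<tau>\<^sub>5 \<sigma> :: real
    and T :: ereal and x :: "real \<Rightarrow> real ^ 'n" and y u\<^sub>1 u\<^sub>2 u w \<xi> :: "real \<Rightarrow> real"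
  assumes plant: "stabilizable A B" "observable A L" "hurwitz (R_poly A B L)"
    and disturbance: "piecewise_cont f" "\<And>t. 0 \<le> t \<Longrightarrow> \<bar>f t\<bar> \<le> fbar"
    and parameters: "p0 > 0" "r > 0" "p1 > 0" "p2 > 0" "p3 > 0" "\<delta> > 0" "\<mu> > 0" "\<beta> > 0" "c > 0" "\<gamma> > 0"
    and weights: "p2 = p0 * (1 + r)" "p3 = p0 * (1 + inverse r)"
    and bounds: "\<And>t. 0 \<le> t \<Longrightarrow> l_y t > 0" "\<And>t. 0 \<le> t \<Longrightarrow> l_u t > 0"
      "\<And>t. 0 \<le> t \<Longrightarrow> gu t = min (l_y t) (l_u t)" "C1_nonneg gl" "C1_nonneg gu"
    and Phi_a: "\<And>e t. 0 \<le> t \<Longrightarrow> gl t < \<Phi> e t \<and> \<Phi> e t < gu t"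
    and Phi_b: "\<And>z t. 0 \<le> t \<Longrightarrow> gl t < z \<Longrightarrow> z < gu t \<Longrightarrow> \<exists>!e. \<Phi> e t = z"
    and Phi_c: "C1_with_partials \<Phi> \<Phi>\<^sub>\<epsilon> \<Phi>\<^sub>t" "\<And>e t. 0 \<le> t \<Longrightarrow> \<Phi>\<^sub>\<epsilon> e t \<noteq> 0"
    and Phi_d: "\<And>e t. 0 \<le> t \<Longrightarrow> \<bar>\<Phi>\<^sub>t e t\<bar> \<le> \<gamma>"
    and Phi_incr: "\<And>e t. 0 \<le> t \<Longrightarrow> \<Phi>\<^sub>\<epsilon> e t > 0"
    and Abar: "Abar = A + k *\<^sub>R outer B L"
    and p1bar: "p1bar = p1 + k\<^sup>2 * p2"
    and phi_bounded: "bounded (phi_bar Abar D L (x 0) f ` {0..})"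
    and phihat: "phihat = (SUP t\<in>{0..}. \<bar>phi_bar Abar D L (x 0) f t\<bar>)"
    and multipliers: "pos_def H" "\<alpha> > 0" "\<tau>\<^sub>1 > 0" "\<tau>\<^sub>2 > 0" "\<tau>\<^sub>3 > 0" "\<tau>\<^sub>4 > 0" "\<tau>\<^sub>5 > 0"
    and LMI_1: "\<And>v. v \<in> {phihat, - phihat} \<Longrightarrow> neg_semidef (vector
         [vector [- \<alpha> + 0.5 * \<tau>\<^sub>1, 0.5 * v * inverse \<mu>, - 0.5],
          vector [0.5 * v * inverse \<mu>, - \<tau>\<^sub>2, 0],
          vector [- 0.5, 0, - \<tau>\<^sub>3]] :: real ^ 3 ^ 3)"
    and LMI_2: "c * \<tau>\<^sub>1 \<ge> phihat\<^sup>2 * \<tau>\<^sub>2 + \<gamma>\<^sup>2 * \<tau>\<^sub>3"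
    and LMI_3: "neg_semidef (sym_block
          (transpose Abar ** H + H ** Abar + \<beta> *\<^sub>R H) (two_columns (H *v B) (H *v D))
          (vector [vector [- \<tau>\<^sub>4, 0], vector [0, - \<tau>\<^sub>5]] :: real ^ 2 ^ 2))"
    and LMI_4: "mat_ge H (p1bar *\<^sub>R outer L L)"
    and LMI_5: "(INF t\<in>{0..}. gu t) / p1bar * \<beta> \<ge> (INF t\<in>{0..}. gu t) / p3 * \<tau>\<^sub>4 + phihat\<^sup>2 * \<tau>\<^sub>5"
    and signals: "\<And>t. y t = L \<bullet> x t" "\<And>t. u\<^sub>1 t = k * y t" "\<And>t. u t = u\<^sub>1 t + u\<^sub>2 t"
      "\<And>t. \<xi> t = p1 * (y t)\<^sup>2 + p2 * (u\<^sub>1 t)\<^sup>2 + p3 * (\<bar>u\<^sub>2 t\<bar> + \<delta>)\<^sup>2"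
    and initial: "\<exists>e0. \<xi> 0 = \<Phi> e0 0"
    and state_equation: "plant_trajectory A B D f T x u"
    and filter_output: "lti_output ([:0, 1:] * R_poly A B L) (Q_poly A - [:k:] * R_poly A B L) T u\<^sub>2 w"
    and sign_zero: "\<bar>\<sigma>\<bar> = 1"
    and control_law: "follows_u2_law \<sigma> p3 \<delta> \<alpha> p1bar \<mu> \<Phi> gl gu T \<xi> y w u\<^sub>2"
  shows "\<forall>t\<ge>0. ereal t < T \<longrightarrow> gl t < \<xi> t \<and> \<xi> t < gu t"
proof -
  have phi_le: "\<bar>phi_bar Abar D L (x 0) f t\<bar> \<le> phihat" if "0 \<le> t" for t
  proof -
    have "bdd_above ((\<lambda>t. \<bar>phi_bar Abar D L (x 0) f t\<bar>) ` {0..})"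
      using phi_bounded by (auto simp: bounded_iff bdd_above_def)
    then show ?thesis unfolding phihat using that by (intro cSUP_upper) auto
  qed
  define \<phi> where "\<phi> = phi_bar Abar D L (x 0) f"
  have u2c: "continuous_on (time_interval T) u\<^sub>2"
    using control_law by (simp add: follows_u2_law_def)
  have u_eq: "\<And>t. u t = k * (L \<bullet> x t) + u\<^sub>2 t" using signals by simp
  note out = output_derivative [OF disturbance(1) Abar u_eq u2c state_equation filter_output, folded \<phi>_def]
  have xc: "continuous_on (time_interval T) x"
    using state_equation by (simp add: plant_trajectory_def)
  have yc: "continuous_on (time_interval T) y"
    unfolding signals by (intro continuous_intros xc)
  have y_int: "((\<lambda>s. w s + \<phi> s) has_integral (y t - y 0)) {0..t}" if t: "t \<in> time_interval T" for t
  proof -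
    have "((\<lambda>s. A *v x s + u s *\<^sub>R B + f s *\<^sub>R D) has_integral (x t - x 0)) {0..t}"
      using state_equation t by (simp add: plant_trajectory_def)
    from has_integral_linear [OF this bounded_linear_inner_right [of L]]
    have "((\<lambda>s. L \<bullet> (A *v x s + u s *\<^sub>R B + f s *\<^sub>R D)) has_integral (y t - y 0)) {0..t}"
      by (simp add: o_def signals inner_diff_right)
    moreover have "L \<bullet> (A *v x s + u s *\<^sub>R B + f s *\<^sub>R D) = w s + \<phi> s" if "s \<in> {0..t}" for s
      using out(2) time_interval_atLeastAtMost [OF t] that by auto
    ultimately show ?thesis by (rule has_integral_eq [rotated])
  qed
  have xi_eq: "\<xi> t = p1bar * (y t)\<^sup>2 + p3 * (\<bar>u\<^sub>2 t\<bar> + \<delta>)\<^sup>2" for t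
    by (simp add: signals p1bar power_mult_distrib algebra_simps)
  have xic: "continuous_on (time_interval T) \<xi>"
    unfolding xi_eq by (intro continuous_intros yc u2c)
  define \<epsilon> where "\<epsilon> t = inverse_map \<Phi> (\<xi> t) t" for t
  have eps: "\<Phi> (\<epsilon> t) t = \<xi> t" if "0 \<le> t" "gl t < \<xi> t" "\<xi> t < gu t" for t
    unfolding \<epsilon>_def inverse_map_def by (rule theI' [OF Phi_b [OF that]])
  have Phi_strict: "\<Phi> e t < \<Phi> e' t" if "e < e'" "0 \<le> t" for e e' t
  proof (rule DERIV_pos_imp_increasing [OF that(1)])
    fix v
    have "((\<lambda>e. \<Phi> e t) has_real_derivative \<Phi>\<^sub>\<epsilon> v t) (at v)"
      using Phi_c(1) that(2) by (simp add: C1_with_partials_def)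
    with Phi_incr [OF that(2)] show "\<exists>d. ((\<lambda>e. \<Phi> e t) has_real_derivative d) (at v) \<and> 0 < d"
      by blast
  qed
  have Phi_less: "\<Phi> e t < \<Phi> e' t \<longleftrightarrow> e < e'" if "0 \<le> t" for e e' t
    using Phi_strict [of e e' t] Phi_strict [of e' e t] that by (cases e e' rule: linorder_cases) auto
  have Phi_lip: "\<bar>\<Phi> e s - \<Phi> e t\<bar> \<le> \<gamma> * \<bar>s - t\<bar>" if "0 \<le> s" "0 \<le> t" for e s t
  proof -
    have "norm (\<Phi> e s - \<Phi> e t) \<le> \<gamma> * norm (s - t)"
    proof (rule field_differentiable_bound [of "{0..}"])
      show "(\<Phi> e has_real_derivative \<Phi>\<^sub>t e v) (at v within {0..})" if "v \<in> {0..}" for v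
        using Phi_c(1) that by (simp add: C1_with_partials_def)
    qed (use Phi_d that in auto)
    then show ?thesis by simp
  qed
  have Phi_cont: "continuous_on {0..t} (\<Phi> e)" for e t
  proof -
    have "(\<Phi> e has_real_derivative \<Phi>\<^sub>t e s) (at s within {0..t})" if "s \<in> {0..t}" for s
    proof -
      have "(\<Phi> e has_real_derivative \<Phi>\<^sub>t e s) (at s within {0..})"
        using Phi_c(1) that by (simp add: C1_with_partials_def)
      then show ?thesis by (rule DERIV_subset) auto
    qed
    then show ?thesis by (rule DERIV_continuous_on)
  qed
  obtain e0 where e0: "\<xi> 0 = \<Phi> e0 0" using initial by blast
  define C where "C = phihat\<^sup>2 / \<mu> + \<gamma>"
  have C: "C > 0" unfolding C_def using parameters by (intro add_nonneg_pos) auto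
  \<comment> \<open>At level \<open>K - 1\<close> the drift \<open>- \<alpha> \<epsilon>\<close> already outweighs disturbance and \<open>\<gamma>\<close> with margin \<open>\<alpha>\<close>; the gap
    between \<open>K - 1\<close> and \<open>K\<close> leaves room for \<open>\<xi>\<close> to be in that region shortly before a contact.\<close>
  define K where "K = \<bar>e0\<bar> + C / \<alpha> + 2"
  have K: "K - 1 > 0" "\<alpha> * (K - 1) \<ge> C + \<alpha>" "- K < e0" "e0 < K"
  proof -
    have "C / \<alpha> > 0" using C multipliers by simp
    then show "K - 1 > 0" "- K < e0" "e0 < K" unfolding K_def by linarith+
    have "\<alpha> * (K - 1) = \<alpha> * \<bar>e0\<bar> + C + \<alpha>"
      using multipliers by (simp add: K_def field_simps)
    then show "\<alpha> * (K - 1) \<ge> C + \<alpha>" using multipliers by simp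
  qed
  define r where "r s = 2 * p1bar * y s * \<phi> s - \<alpha> * \<epsilon> s - \<mu> * p1bar\<^sup>2 * sgn (\<epsilon> s) * (y s)\<^sup>2" for s
  have young: "2 * \<bar>p1bar * y s * \<phi> s\<bar> \<le> \<mu> * p1bar\<^sup>2 * (y s)\<^sup>2 + phihat\<^sup>2 / \<mu>" if "0 \<le> s" for s
  proof -
    have "0 \<le> (\<mu> * \<bar>p1bar * y s\<bar> - \<bar>\<phi> s\<bar>)\<^sup>2 / \<mu>" using parameters by simp
    also have "\<dots> = \<mu> * (p1bar * y s)\<^sup>2 - 2 * \<bar>p1bar * y s * \<phi> s\<bar> + (\<phi> s)\<^sup>2 / \<mu>"
      using parameters by (simp add: power2_eq_square abs_mult field_simps)
    finally have "2 * \<bar>p1bar * y s * \<phi> s\<bar> \<le> \<mu> * (p1bar * y s)\<^sup>2 + (\<phi> s)\<^sup>2 / \<mu>" by simp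
    moreover have "(\<phi> s)\<^sup>2 \<le> phihat\<^sup>2"
      using power_mono [OF phi_le [OF that], of 2] by (simp add: \<phi>_def)
    then have "(\<phi> s)\<^sup>2 / \<mu> \<le> phihat\<^sup>2 / \<mu>" using parameters by (simp add: divide_right_mono)
    ultimately show ?thesis by (simp add: power_mult_distrib)
  qed
  have drift_up: "r s \<le> - (\<gamma> + \<alpha>)" if "0 \<le> s" "K - 1 < \<epsilon> s" for s
  proof -
    have "\<alpha> * (K - 1) \<le> \<alpha> * \<epsilon> s" using that multipliers by (intro mult_left_mono) auto
    moreover have "sgn (\<epsilon> s) = 1" using that K by simp
    ultimately show ?thesis using young [OF that(1)] K(2) unfolding r_def C_def by (simp add: mult.assoc)
  qed
  have drift_down: "\<gamma> + \<alpha> \<le> r s" if "0 \<le> s" "\<epsilon> s < - (K - 1)" for s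
  proof -
    have "\<alpha> * (K - 1) \<le> \<alpha> * - \<epsilon> s" using that multipliers by (intro mult_left_mono) auto
    moreover have "sgn (\<epsilon> s) = - 1" using that K by simp
    ultimately show ?thesis using young [OF that(1)] K(2) unfolding r_def C_def by (simp add: mult.assoc)
  qed
  have band: "\<Phi> (- K) b < \<xi> b \<and> \<xi> b < \<Phi> K b" if b: "b \<in> time_interval T" for b
  proof (rule ccontr)
    assume neg: "\<not> ?thesis"
    \<comment> \<open>The law for \<open>u\<^sub>2\<close> holds only as long as \<open>\<xi>\<close> stays between \<open>gl\<close> and \<open>gu\<close>; up to the first time at
      which \<open>\<xi>\<close> touches a barrier this is guaranteed, since the barriers lie strictly between them.\<close>
    define m where "m t = min (\<xi> t - \<Phi> (- K) t) (\<Phi> K t - \<xi> t)" for t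
    have b0: "0 \<le> b" using b by (simp add: time_interval_def)
    note subT = time_interval_atLeastAtMost [OF b]
    have "continuous_on {0..b} m"
      unfolding m_def by (intro continuous_intros Phi_cont continuous_on_subset [OF xic subT])
    moreover have "m 0 > 0" using Phi_less [of 0] K by (simp add: m_def e0)
    moreover have "m b \<le> 0" using neg by (auto simp: m_def)
    ultimately obtain t where t: "0 < t" "t \<le> b" "m t = 0" and mpos: "\<And>s. 0 \<le> s \<Longrightarrow> s < t \<Longrightarrow> m s > 0"
      using first_zero [OF _ b0] by blast
    have tT: "{0..t} \<subseteq> time_interval T" using t subT by auto
    have inside: "\<Phi> (- K) s \<le> \<xi> s" "\<xi> s \<le> \<Phi> K s" if "s \<in> {0..t}" for s
      using mpos [of s] t(3) that by (cases "s = t"; auto simp: m_def)+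
    have gap: "gl s < \<xi> s" "\<xi> s < gu s" if "s \<in> {0..t}" for s
      using inside [OF that] Phi_a [of s "- K"] Phi_a [of s K] that by auto
    have eps': "\<Phi> (\<epsilon> s) s = \<xi> s" if "s \<in> {0..t}" for s
      using eps gap [OF that] that by auto
    have eps_le: "\<bar>\<epsilon> s\<bar> \<le> K" if "s \<in> {0..t}" for s
      using inside [OF that] Phi_less [of s K "\<epsilon> s"] Phi_less [of s "\<epsilon> s" "- K"] eps' [OF that] that
      by (auto simp: abs_le_iff)
    have r0: "(r has_integral (\<xi> s - \<xi> 0)) {0..s}" if s: "s \<in> {0..t}" for s
      unfolding r_def [abs_def] xi_eq
    proof (rule energy_balance [OF _ _ _ _ _ _ eps_le parameters(5) parameters(6) sign_zero s])
      show "continuous_on {0..t} y" "continuous_on {0..t} w" "continuous_on {0..t} u\<^sub>2"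
        using yc out(1) u2c tT by (auto intro: continuous_on_subset)
      show "\<bar>\<phi> v\<bar> \<le> phihat" if "v \<in> {0..t}" for v
        using phi_le that by (simp add: \<phi>_def)
      show "((\<lambda>v. w v + \<phi> v) has_integral (y v - y 0)) {0..v}" if "v \<in> {0..t}" for v
        using y_int tT that by auto
      show "((\<lambda>s. u2_rhs \<sigma> p3 \<delta> \<alpha> p1bar \<mu> (u\<^sub>2 s) (\<epsilon> s) (y s) (w s)) has_integral (u\<^sub>2 v - u\<^sub>2 0)) {0..v}"
        if "v \<in> {0..t}" for v
        using control_law tT that gap unfolding follows_u2_law_def \<epsilon>_def by auto
    qed
    have r_int: "(r has_integral (\<xi> t - \<xi> s)) {s..t}" if s: "0 \<le> s" "s \<le> t" for s
    proof -
      have t_int: "r integrable_on {0..t}" using r0 [of t] t by auto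
      have "integral {0..s} r + integral {s..t} r = integral {0..t} r"
        by (rule Henstock_Kurzweil_Integration.integral_combine [OF s t_int])
      moreover have "integral {0..s} r = \<xi> s - \<xi> 0" "integral {0..t} r = \<xi> t - \<xi> 0"
        using r0 s t by (auto intro!: integral_unique)
      ultimately have "integral {s..t} r = \<xi> t - \<xi> s" by simp
      moreover have "r integrable_on {s..t}"
        by (rule integrable_subinterval_real [OF t_int]) (use s in auto)
      ultimately show ?thesis using integrable_integral by metis
    qed
    have xict: "continuous_on {0..t} \<xi>" by (rule continuous_on_subset [OF xic tT])
    from t(3) consider "\<xi> t = \<Phi> K t" | "\<xi> t = \<Phi> (- K) t" by (auto simp: m_def min_def split: if_splits)
    then show False
    proof cases
      case 1
      have "\<xi> t \<noteq> \<Phi> K t"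
      proof (rule no_contact [where a' = "\<Phi> (K - 1)" and r = r and c = "\<gamma> + \<alpha>" and \<gamma> = \<gamma>,
            OF t(1) xict Phi_cont])
        show "\<xi> s < \<Phi> K s" if "0 \<le> s" "s < t" for s
          using mpos [OF that] by (simp add: m_def)
        show "\<Phi> (K - 1) t < \<xi> t" unfolding 1 using t by (intro Phi_strict) auto
        show "r s \<le> - (\<gamma> + \<alpha>)" if "0 \<le> s" "s \<le> t" "\<Phi> (K - 1) s < \<xi> s" for s
          using that Phi_less [of s "K - 1" "\<epsilon> s"] eps' [of s] by (intro drift_up) auto
        show "\<Phi> K s - \<Phi> K t \<le> \<gamma> * (t - s)" if "0 \<le> s" "s \<le> t" for s
          using Phi_lip [of s t K] that by auto
      qed (use r_int multipliers in auto)
      with 1 show False by simp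
    next
      case 2
      have "- \<xi> t \<noteq> - \<Phi> (- K) t"
      proof (rule no_contact [where a' = "\<lambda>s. - \<Phi> (- (K - 1)) s" and r = "\<lambda>s. - r s"
            and c = "\<gamma> + \<alpha>" and \<gamma> = \<gamma> and \<xi> = "\<lambda>s. - \<xi> s" and a = "\<lambda>s. - \<Phi> (- K) s",
            OF t(1) continuous_on_minus [OF xict] continuous_on_minus [OF Phi_cont]])
        show "- \<xi> s < - \<Phi> (- K) s" if "0 \<le> s" "s < t" for s
          using mpos [OF that] by (simp add: m_def)
        show "- \<Phi> (- (K - 1)) t < - \<xi> t"
          unfolding 2 using t Phi_strict [of "- K" "- (K - 1)" t] by auto
        show "((\<lambda>s. - r s) has_integral (- \<xi> t - - \<xi> s)) {s..t}" if "0 \<le> s" "s \<le> t" for s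
          using has_integral_neg [OF r_int [OF that]] by simp
        show "- r s \<le> - (\<gamma> + \<alpha>)" if "0 \<le> s" "s \<le> t" "- \<Phi> (- (K - 1)) s < - \<xi> s" for s
          using that Phi_less [of s "\<epsilon> s" "- (K - 1)"] eps' [of s] drift_down [of s] by auto
        show "- \<Phi> (- K) s - - \<Phi> (- K) t \<le> \<gamma> * (t - s)" if "0 \<le> s" "s \<le> t" for s
          using Phi_lip [of s t "- K"] that by auto
      qed (use multipliers in auto)
      with 2 show False by simp
    qed
  qed
  show ?thesis
  proof (intro allI impI)
    fix t :: real assume t: "0 \<le> t" "ereal t < T"
    then have "\<Phi> (- K) t < \<xi> t \<and> \<xi> t < \<Phi> K t" by (intro band) (simp add: time_interval_def)
    then show "gl t < \<xi> t \<and> \<xi> t < gu t"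
      using Phi_a [OF t(1), of "- K"] Phi_a [OF t(1), of K] by auto
  qed
qed

end
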